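(* Let $n\geq3$ be an odd integer and $p=\frac{n-3}2$. Then for all angle structures $\alpha=(a_1,\dots,c_W)\in\mathcal A_{X_n}$ and all $\hbar>0$ (of the form $\hbar=(\mathsf b+\mathsf b^{-1})^{-2}$ with $\mathsf b>0$), one has $$|\mathcal Z_\hbar(X_n,\alpha)|=\left|\int_{\mathbb R+i\frac{\mu_{X_n}(\alpha)}{2\pi\sqrt\hbar}}J_{X_n}(\hbar,x)\,e^{\frac1{2\sqrt\hbar}x\lambda_{X_n}(\alpha)}\,dx\right|,$$ with $\mu_{X_n}(\alpha)=a_U-a_V$, $\lambda_{X_n}(\alpha)=2(a_U-a_V+c_V-b_W)$ and $$J_{X_n}(\hbar,x)=\int_{\mathcal Y'}d\mathbf y'\;e^{2i\pi\left(\mathbf y'^\top Q_n\mathbf y'+x(x-y'_U-y'_W)\right)}\,e^{\frac1{\sqrt\hbar}\left(\mathbf y'^\top\mathcal W_n-\pi x\right)}\,\frac{\Phi_{\mathsf b}(y'_U)\,\Phi_{\mathsf b}(y'_U+x)\,\Phi_{\mathsf b}(y'_W)}{\Phi_{\mathsf b}(y'_1)\cdots\Phi_{\mathsf b}(y'_p)},$$ where $\mathbf y'=(y'_1,\dots,y'_p,y'_U,y'_W)^\top$, $$\mathcal Y'=\mathcal Y'_{\hbar,\alpha}=\prod_{k=1}^p\Big(\mathbb R-\tfrac{i}{2\pi\sqrt\hbar}(\pi-a_k)\Big)\times\prod_{l=U,W}\Big(\mathbb R+\tfrac{i}{2\pi\sqrt\hbar}(\pi-a_l)\Big),$$ $\mathcal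 W_n$ is the vector with entries $-2\pi\big(kp-\frac{k(k-1)}2\big)$ for $k=1,\dots,p$, then $(p^2+p+1)\pi$ (index $U$) and $\pi$ (index $W$), and $Q_n$ is the symmetric matrix indexed by $1,\dots,p,U,W$ with $(Q_n)_{jk}=\min(j,k)$ and $(Q_n)_{jU}=-j$ for $1\le j,k\le p$, $(Q_n)_{UU}=p$, $(Q_n)_{UW}=\frac12$, and all entries $(Q_n)_{jW}$ ($1\le j\le p$) and $(Q_n)_{WW}$ equal to $0$.
   Context: Triangulations: a tetrahedron $T$ has totally ordered vertices $0,1,2,3$ and a sign $\varepsilon(T)=\pm1$ (recording whether the vertex order agrees with the orientation); $x_k(T)$ is its face opposite to vertex $k$. A triangulation $X$ consists of finitely many tetrahedra whose faces are all glued in pairs by the unique affine isomorphisms preserving vertex order; faces with the same name are glued. $X^k$ is the set of $k$-cells after gluing. $X_n$ ($n\geq3$ odd, $p=\frac{n-3}2$), an ideal triangulation of the complement of the twist knot $K_n$ with $n$ half-twists, has tetrahedra $T_1,\dots,T_p,U,V,W$ and faces $e_1,\dots,e_{p+1},f_1,\dots,f_p,v,r,s,g,u$, with $f_0:=e_1$. Writing $T:(x_0,x_1,x_2,x_3)$: $T_k:(e_k,e_{k+1},f_k,f_{k-1})$ of sign $+1$ ($1\le k\le p$); $U:(r,v,s,g)$, $V:(g,s,f_p,u)$, $W:(u,r,v,e_{p+1})$, all of sign $-1$. Angle structures: $\mathcal A_X$ is the set of $\alpha=(a_T,b_T,c_T)_{T\in X^3}$ with $a_T,b_T,c_T\in(0,\pi)$,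 $a_T+b_T+c_T=\pi$ ($a_T$ at edges $01,23$, $b_T$ at $02,13$, $c_T$ at $03,12$), such that for every $e\in X^1$ the angles at all tetrahedral edges identified to $e$ sum to $2\pi$. Indices $k$, $U$, $V$, $W$ refer to the tetrahedra $T_k,U,V,W$. Quantum dilogarithm: $\mathsf b>0$, $\hbar=(\mathsf b+\mathsf b^{-1})^{-2}$, $$\Phi_{\mathsf b}(z)=\exp\Big(\tfrac14\int_{\mathbb R+i0^+}\frac{e^{-2izw}\,dw}{\sinh(\mathsf bw)\sinh(\mathsf b^{-1}w)w}\Big)\quad\text{for }|\mathrm{Im}\,z|<\tfrac1{2\sqrt\hbar}$$ (contour: real line avoiding $0$ from above), extended meromorphically to $\mathbb C$. Partition function: attach real variables $t_T$ to tetrahedra and variables to faces (denoted by the names of the faces). The kinematical kernel is the tempered distribution on $\mathbb R^{X^3}$ $$\mathcal K_X(\mathbf t)=\int_{\mathbb R^{X^2}}d\mathbf x\prod_{T\in X^3}e^{2i\pi\varepsilon(T)x_0(T)t_T}\,\delta\big(x_0(T)-x_1(T)+x_2(T)\big)\,\delta\big(x_2(T)-x_3(T)+t_T\big),$$ where $x_i(T)$ denotes the component of $\mathbf x\in\mathbb R^{X^2}$ indexed by that face, and the Dirac deltas are understood via $\delta(x)=\int_{\mathbb R}e^{-2\pi ixw}dw$ (Fourier inversion). If the linear map $\mathbf x\mapsto A\mathbf x$ collecting the face-variable parts of the arguments of the deltas is invertible, this is the bounded function obtained by solving these linear equations for $\mathbf x$ and multiplying by $|\det A|^{-1}$. The dynamical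 content is $$\mathcal D_{\hbar,X}(\mathbf t,\alpha)=\prod_{T\in X^3}\frac{\exp(\hbar^{-1/2}c_Tt_T)}{\Phi_{\mathsf b}\big(t_T-\frac{i}{2\pi\sqrt\hbar}\varepsilon(T)(\pi-a_T)\big)^{\varepsilon(T)}},$$ and $\mathcal Z_\hbar(X,\alpha)=\int_{\mathbb R^{X^3}}\mathcal K_X(\mathbf t)\,\mathcal D_{\hbar,X}(\mathbf t,\alpha)\,d\mathbf t$. *)

theory Defs
  imports
    "HOL-Complex_Analysis.Complex_Analysis"
    "Jordan_Normal_Form.Determinant"
begin

section \<open>Ordered triangulations\<close>

text \<open>
  A triangulation is recorded by its list of tetrahedra (the order only serves to write down
  matrices), their signs, and the name \<open>face X T k\<close> of the face of \<open>T\<close> opposite to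
  vertex \<open>k\<close>, for \<open>k = 0, 1, 2, 3\<close>.  Faces with the same name are glued, by the unique affine
  isomorphism that preserves the order of the vertices.
\<close>

record ('t, 'f) triangulation =
  tets :: "'t list"
  sgn_tet :: "'t \<Rightarrow> int"
  face :: "'t \<Rightarrow> nat \<Rightarrow> 'f"

definition face_list :: "('t, 'f) triangulation \<Rightarrow> 'f list" where
  "face_list X = remdups (concat (map (\<lambda>T. map (face X T) [0..<4]) (tets X)))"

text \<open>\<open>(T, i, j)\<close> with \<open>i < j\<close> is the edge of \<open>T\<close> joining the vertices \<open>i\<close> and \<open>j\<close>.\<close>

definition tet_edges :: "('t, 'f) triangulation \<Rightarrow> ('t \<times> nat \<times> nat) set" where
  "tet_edges X = {(T, i, j) | T i j. T \<in> set (tets X) \<and> i < j \<and> j < 4}"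

text \<open>The \<open>m\<close>-th vertex (\<open>m = 0, 1, 2\<close>) of the face opposite to vertex \<open>k\<close>.\<close>

definition face_vertex :: "nat \<Rightarrow> nat \<Rightarrow> nat" where
  "face_vertex k m = (if m < k then m else Suc m)"

definition edge_gluing ::
  "('t, 'f) triangulation \<Rightarrow> (('t \<times> nat \<times> nat) \<times> ('t \<times> nat \<times> nat)) set" where
  "edge_gluing X =
     {((T, face_vertex k m, face_vertex k m'), (T', face_vertex l m, face_vertex l m'))
      | T T' k l m m'. T \<in> set (tets X) \<and> T' \<in> set (tets X) \<and> k < 4 \<and> l < 4 \<and>
          face X T k = face X T' l \<and> m < m' \<and> m' < 3}"

text \<open>\<open>edge_gluing\<close> is symmetric, so its reflexive transitive closure is the equivalence
  relation it generates.\<close>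

definition edges :: "('t, 'f) triangulation \<Rightarrow> ('t \<times> nat \<times> nat) set set" where
  "edges X = tet_edges X // (edge_gluing X)\<^sup>*"

section \<open>Angle structures\<close>

fun dihedral_angle ::
  "('t \<Rightarrow> real) \<times> ('t \<Rightarrow> real) \<times> ('t \<Rightarrow> real) \<Rightarrow> 't \<times> nat \<times> nat \<Rightarrow> real" where
  "dihedral_angle (a, b, c) (T, i, j) =
     (if (i, j) \<in> {(0, 1), (2, 3)} then a T
      else if (i, j) \<in> {(0, 2), (1, 3)} then b T
      else c T)"

definition angle_structures ::
  "('t, 'f) triangulation \<Rightarrow> (('t \<Rightarrow> real) \<times> ('t \<Rightarrow> real) \<times> ('t \<Rightarrow> real)) set" where
  "angle_structures X =
     {(a, b, c) | a b c.
        (\<forall>T\<in>set (tets X). a T \<in> {0<..<pi} \<and> b T \<in> {0<..<pi} \<and> c T \<in> {0<..<pi} \<and>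
           a T + b T + c T = pi) \<and>
        (\<forall>e\<in>edges X. (\<Sum>\<epsilon>\<in>e. dihedral_angle (a, b, c) \<epsilon>) = 2 * pi)}"

section \<open>Faddeev's quantum dilogarithm\<close>

definition hbar :: "real \<Rightarrow> real" where
  "hbar \<beta> = 1 / (\<beta> + 1 / \<beta>)\<^sup>2"

text \<open>
  The contour \<open>\<real> + i0\<^sup>+\<close> is the line \<open>\<real> + i\<eta>\<close> in the limit \<open>\<eta> \<rightarrow> 0+\<close>.
\<close>

definition quantum_dilog_strip :: "real \<Rightarrow> complex \<Rightarrow> complex" where
  "quantum_dilog_strip \<beta> z =
     exp (1 / 4 * Lim (at_right 0) (\<lambda>\<eta>::real. LINT u|lborel.
       (let w = complex_of_real u + \<i> * complex_of_real \<eta>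
        in exp (- 2 * \<i> * z * w)
             / (sinh (complex_of_real \<beta> * w) * sinh (complex_of_real (1 / \<beta>) * w) * w))))"

definition dilog_strip :: "real \<Rightarrow> complex set" where
  "dilog_strip \<beta> = {z. \<bar>Im z\<bar> < 1 / (2 * sqrt (hbar \<beta>))}"

text \<open>Outside the strip this is the meromorphic extension, with value \<open>0\<close> at the poles; the
  identity theorem makes it unique.\<close>

definition quantum_dilog :: "real \<Rightarrow> complex \<Rightarrow> complex" where
  "quantum_dilog \<beta> z =
     (if z \<in> dilog_strip \<beta> then quantum_dilog_strip \<beta> z
      else (THE f. f nicely_meromorphic_on UNIV \<and>
                   (\<forall>w\<in>dilog_strip \<beta>. f w = quantum_dilog_strip \<beta> w)) z)"

section \<open>The partition function\<close>

text \<open>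
  Each tetrahedron \<open>T\<close> contributes two deltas, with arguments
  \<open>x\<^sub>0(T) - x\<^sub>1(T) + x\<^sub>2(T)\<close> and \<open>x\<^sub>2(T) - x\<^sub>3(T) + t\<^sub>T\<close>.  The following matrix collects their
  face-variable parts, two rows for each tetrahedron and one column for each face; coefficients of
  a face that occurs several times in \<open>T\<close> are added up.
\<close>

definition delta_matrix :: "('t, 'f) triangulation \<Rightarrow> real mat" where
  "delta_matrix X =
     Matrix.mat (2 * length (tets X)) (length (face_list X)) (\<lambda>(r, s).
       let x = face X (tets X ! (r div 2)); y = face_list X ! s
       in if even r then of_bool (x 0 = y) - of_bool (x 1 = y) + of_bool (x 2 = y)
          else of_bool (x 2 = y) - of_bool (x 3 = y))"

definition delta_solution ::
  "('t, 'f) triangulation \<Rightarrow> ('t \<Rightarrow> real) \<Rightarrow> 'f \<Rightarrow> real" where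
  "delta_solution X t =
     (THE x. x \<in> extensional (set (face_list X)) \<and>
        (\<forall>T\<in>set (tets X).
           x (face X T 0) - x (face X T 1) + x (face X T 2) = 0 \<and>
           x (face X T 2) - x (face X T 3) + t T = 0))"

text \<open>
  The kinematical kernel is a priori a tempered distribution.  When the delta matrix is invertible
  it is the bounded function obtained by eliminating the deltas; in the degenerate case, where the
  distribution need not be a function, it is left unspecified.
\<close>

definition kinematical_kernel ::
  "('t, 'f) triangulation \<Rightarrow> ('t \<Rightarrow> real) \<Rightarrow> complex" where
  "kinematical_kernel X t =
     (if invertible_mat (delta_matrix X) then
        (let x = delta_solution X t in
         (\<Prod>T\<in>set (tets X).
            exp (2 * \<i> * of_real pi * of_int (sgn_tet X T) * of_real (x (face X T 0)) * of_real (t T)))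
         / of_real \<bar>Determinant.det (delta_matrix X)\<bar>)
      else undefined)"

definition dynamical_content ::
  "real \<Rightarrow> ('t, 'f) triangulation \<Rightarrow> ('t \<Rightarrow> real)
     \<Rightarrow> ('t \<Rightarrow> real) \<times> ('t \<Rightarrow> real) \<times> ('t \<Rightarrow> real) \<Rightarrow> complex" where
  "dynamical_content \<beta> X t = (\<lambda>(a, b, c).
     \<Prod>T\<in>set (tets X).
       exp (of_real (c T * t T / sqrt (hbar \<beta>)))
       / quantum_dilog \<beta>
           (of_real (t T)
            - \<i> / of_real (2 * pi * sqrt (hbar \<beta>)) * of_int (sgn_tet X T) * of_real (pi - a T))
         powi sgn_tet X T)"

definition partition_integrand ::
  "real \<Rightarrow> ('t, 'f) triangulation \<Rightarrow> ('t \<Rightarrow> real) \<times> ('t \<Rightarrow> real) \<times> ('t \<Rightarrow> real)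
     \<Rightarrow> ('t \<Rightarrow> real) \<Rightarrow> complex" where
  "partition_integrand \<beta> X \<alpha> t = kinematical_kernel X t * dynamical_content \<beta> X t \<alpha>"

definition partition_function ::
  "real \<Rightarrow> ('t, 'f) triangulation \<Rightarrow> ('t \<Rightarrow> real) \<times> ('t \<Rightarrow> real) \<times> ('t \<Rightarrow> real) \<Rightarrow> complex" where
  "partition_function \<beta> X \<alpha> =
     (LINT t|(\<Pi>\<^sub>M T\<in>set (tets X). lborel). partition_integrand \<beta> X \<alpha> t)"

section \<open>The triangulations of the twist knot complements\<close>

datatype twist_tet = TT nat | TU | TV | TW

datatype twist_face = Fe nat | Ff nat | Fv | Fr | Fs | Fg | Fu

text \<open>The convention \<open>f\<^sub>0 = e\<^sub>1\<close>.\<close>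

definition twist_f :: "nat \<Rightarrow> twist_face" where
  "twist_f k = (if k = 0 then Fe 1 else Ff k)"

fun twist_faces :: "nat \<Rightarrow> twist_tet \<Rightarrow> twist_face list" where
  "twist_faces p (TT k) = [Fe k, Fe (k + 1), twist_f k, twist_f (k - 1)]"
| "twist_faces p TU = [Fr, Fv, Fs, Fg]"
| "twist_faces p TV = [Fg, Fs, twist_f p, Fu]"
| "twist_faces p TW = [Fu, Fr, Fv, Fe (p + 1)]"

text \<open>For the twist knot with \<open>n = 2 p + 3\<close> half-twists.\<close>

definition twist_triangulation :: "nat \<Rightarrow> (twist_tet, twist_face) triangulation" where
  "twist_triangulation p =
     \<lparr> tets = map TT [1..<p + 1] @ [TU, TV, TW],
       sgn_tet = (\<lambda>T. case T of TT k \<Rightarrow> 1 | _ \<Rightarrow> - 1),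
       face = (\<lambda>T k. twist_faces p T ! k) \<rparr>"

section \<open>The function $J$\<close>

text \<open>The index set \<open>1, \<dots>, p, U, W\<close> of the vectors $y'$.\<close>

definition J_index :: "nat \<Rightarrow> twist_tet set" where
  "J_index p = TT ` {1..p} \<union> {TU, TW}"

fun Q_mat :: "nat \<Rightarrow> twist_tet \<Rightarrow> twist_tet \<Rightarrow> real" where
  "Q_mat p (TT j) (TT k) = real (min j k)"
| "Q_mat p (TT j) TU = - real j"
| "Q_mat p TU (TT j) = - real j"
| "Q_mat p TU TU = real p"
| "Q_mat p TU TW = 1 / 2"
| "Q_mat p TW TU = 1 / 2"
| "Q_mat p _ _ = 0"

fun W_vec :: "nat \<Rightarrow> twist_tet \<Rightarrow> real" where
  "W_vec p (TT k) = - 2 * pi * (real k * real p - real k * (real k - 1) / 2)"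
| "W_vec p TU = ((real p)\<^sup>2 + real p + 1) * pi"
| "W_vec p TW = pi"
| "W_vec p TV = 0"

definition J_integrand :: "real \<Rightarrow> nat \<Rightarrow> complex \<Rightarrow> (twist_tet \<Rightarrow> complex) \<Rightarrow> complex" where
  "J_integrand \<beta> p x y =
     exp (2 * \<i> * of_real pi *
          ((\<Sum>i\<in>J_index p. \<Sum>j\<in>J_index p. y i * of_real (Q_mat p i j) * y j)
           + x * (x - y TU - y TW)))
   * exp (1 / of_real (sqrt (hbar \<beta>)) *
          ((\<Sum>i\<in>J_index p. y i * of_real (W_vec p i)) - of_real pi * x))
   * (quantum_dilog \<beta> (y TU) * quantum_dilog \<beta> (y TU + x) * quantum_dilog \<beta> (y TW)
      / (\<Prod>k=1..p. quantum_dilog \<beta> (y (TT k))))"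

text \<open>The point of the contour $\mathcal{Y}'$ with real part \<open>u\<close>.\<close>

definition Y_point :: "real \<Rightarrow> (twist_tet \<Rightarrow> real) \<Rightarrow> (twist_tet \<Rightarrow> real) \<Rightarrow> twist_tet \<Rightarrow> complex" where
  "Y_point \<beta> a u T =
     (case T of
        TT k \<Rightarrow> of_real (u T) - \<i> / of_real (2 * pi * sqrt (hbar \<beta>)) * of_real (pi - a T)
      | _ \<Rightarrow> of_real (u T) + \<i> / of_real (2 * pi * sqrt (hbar \<beta>)) * of_real (pi - a T))"

definition J_fun :: "real \<Rightarrow> nat \<Rightarrow> (twist_tet \<Rightarrow> real) \<Rightarrow> complex \<Rightarrow> complex" where
  "J_fun \<beta> p a x =
     (LINT u|(\<Pi>\<^sub>M T\<in>J_index p. lborel). J_integrand \<beta> p x (Y_point \<beta> a u))"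

end

theory Submission
  imports Defs
begin

text \<open>
  After a linear change of variables, the integrand of the partition function and that of the
  right-hand side differ by a constant phase.  The theorem is this identity together with absolute
  convergence.

  \<^emph>\<open>The kernel.\<close>  The delta equations of \<open>X\<^sub>n\<close> are solvable over the integers for every integral
  right-hand side, hence the delta matrix is unimodular and contributes no factor
  (\<open>delta_matrix_twist\<close>).  Their explicit solution (\<open>twist_delta_solution\<close>) turns the kernel into
  \<open>exp (2 \<pi> i q(t))\<close>, where \<open>q\<close> is exactly the quadratic form \<open>y\<^sup>T Q\<^sub>n y + x (x - y\<^sub>U - y\<^sub>W)\<close> evaluated at
  \<open>y = t\<close> and \<open>x = t\<^sub>V - t\<^sub>U\<close> (\<open>kinematical_kernel_twist\<close>).

  \<^emph>\<open>The angles.\<close>  The arguments of the dilogarithms are \<open>y\<^sub>T = t\<^sub>T + i h\<^sub>T\<close>, with \<open>h\<^sub>T\<close> an explicit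
  multiple of \<open>\<plusminus>(\<pi> - a\<^sub>T)\<close>; they run through the contour of the right-hand side, with
  \<open>x = y\<^sub>V - y\<^sub>U\<close> on the line of height given by \<open>a\<^sub>U - a\<^sub>V\<close>.  Replacing \<open>t\<close> by \<open>y\<close> in \<open>q\<close> adds
  a real constant and \<open>i\<close> times a linear form in \<open>t\<close>.  The linear form, the vector \<open>W\<^sub>n\<close> and
  \<open>\<lambda>\<close> together must reproduce the exponent \<open>\<Sum> c\<^sub>T t\<^sub>T\<close> of the dynamical content.  This is where the
  angle structure enters: the edge equations, found by labelling the edges of the tetrahedra so that
  the labels are the edge classes, express \<open>c\<^sub>k\<close>, \<open>c\<^sub>W\<close> and \<open>c\<^sub>U + c\<^sub>V\<close> through the \<open>a\<^sub>T\<close>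
  (\<open>twist_angle_equations\<close>), and the comparison is \<open>twist_linear_identity\<close>.

  \<^emph>\<open>Convergence.\<close>  On a horizontal line of height \<open>y\<close> in its strip, \<open>\<bar>\<Phi>\<^sub>b(t + i y)\<bar>\<close> is bounded
  above and below by constant multiples of \<open>1\<close> for \<open>t \<le> 0\<close> and of \<open>exp (-2 \<pi> t y)\<close> for \<open>t \<ge> 0\<close>
  (\<open>ln_norm_quantum_dilog_asymptotics\<close>): the defining integral is bounded directly in the first
  case, and after moving the contour below the triple pole at \<open>0\<close>, whose residue is
  \<open>C - 2 z\<^sup>2\<close>, in the second.  Multiplied by \<open>exp (c t / sqrt hbar)\<close>, the
  factor of a tetrahedron decays like \<open>exp (c t / sqrt hbar)\<close> on the left and like
  \<open>exp (- b t / sqrt hbar)\<close> on the right, because \<open>a + b + c = \<pi>\<close>.  All three angles being positive, the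
  integrand of the partition function is a product of integrable functions up to a phase, and Fubini
  for the shear \<open>t\<^sub>V = u + t\<^sub>U\<close> (\<open>integral_shear\<close>) gives all four claims.
\<close>

section \<open>Shifting contours in a strip\<close>

lemma has_contour_integral_horizontal_iff:
  assumes "a < b"
  shows "(f has_contour_integral I) (linepath (Complex a \<eta>) (Complex b \<eta>)) \<longleftrightarrow>
           ((\<lambda>u. f (Complex u \<eta>)) has_integral I) {a..b}"
proof -
  have "linepath (Complex a \<eta>) (Complex b \<eta>)
          = (+) (\<i> * of_real \<eta>) \<circ> linepath (of_real a) (of_real b)"
    by (auto simp: linepath_def fun_eq_iff complex_eq_iff algebra_simps)
  then show ?thesis
    using assms
    by (simp add: has_contour_integral_translate has_contour_integral_linepath_Reals_iff Complex_eq)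
qed

lemma lborel_integral_symmetric_interval_tendsto:
  fixes h :: "real \<Rightarrow> complex"
  assumes "integrable lborel h"
  shows "(\<lambda>n. integral {- real n..real n} h) \<longlonglongrightarrow> (LINT u|lborel. h u)"
proof -
  note [measurable] = borel_measurable_integrable[OF assms]
  have eq: "integral {- real n..real n} h = (LINT u|lborel. indicator {- real n..real n} u *\<^sub>R h u)" for n
    using set_borel_integral_eq_integral(2)[OF set_integrable_subset[of lborel UNIV h "{- real n..real n}"]] assms
    by (simp add: set_lebesgue_integral_def set_integrable_def)
  have "(\<lambda>n. LINT u|lborel. indicator {- real n..real n} u *\<^sub>R h u) \<longlonglongrightarrow> (LINT u|lborel. h u)"
  proof (rule integral_dominated_convergence[where w = "\<lambda>u. norm (h u)"])
    show "AE u in lborel. (\<lambda>n. indicator {- real n..real n} u *\<^sub>R h u) \<longlonglongrightarrow> h u"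
    proof (rule AE_I2, rule tendsto_eventually)
      fix u :: real
      obtain N where "\<bar>u\<bar> \<le> real N" using real_arch_simple by blast
      then show "\<forall>\<^sub>F n in sequentially. indicator {- real n..real n} u *\<^sub>R h u = h u"
        unfolding eventually_sequentially
        by (intro exI[of _ N]) (auto simp: indicator_def abs_le_iff)
    qed
  qed (use assms in \<open>auto simp: indicator_def integrable_norm_iff\<close>)
  then show ?thesis by (simp add: eq)
qed

text \<open>
  The residue theorem on the rectangles with corners \<open>\<plusminus>n + i \<alpha>\<close> and \<open>\<plusminus>n + i \<gamma>\<close>: the vertical sides
  disappear in the limit because of the exponential decay.  The case of a strip without the
  singularity is included, with winding number \<open>0\<close>, so that one lemma serves both for the
  independence of the contour and for the passage across the pole.
\<close>

lemma strip_contour_shift: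
  fixes f :: "complex \<Rightarrow> complex"
  assumes holo: "f holomorphic_on {w. \<bar>Im w\<bar> < \<rho>} - {0}"
    and lines: "- \<rho> < \<alpha>" "\<alpha> < \<gamma>" "\<gamma> < \<rho>" "\<alpha> \<noteq> 0" "\<gamma> \<noteq> 0"
    and decay: "\<And>w. R0 \<le> \<bar>Re w\<bar> \<Longrightarrow> \<alpha> \<le> Im w \<Longrightarrow> Im w \<le> \<gamma> \<Longrightarrow> norm (f w) \<le> C * exp (- \<delta> * \<bar>Re w\<bar>)"
    and "\<delta> > 0"
    and int: "integrable lborel (\<lambda>u. f (Complex u \<alpha>))" "integrable lborel (\<lambda>u. f (Complex u \<gamma>))"
  shows "(LINT u|lborel. f (Complex u \<alpha>)) - (LINT u|lborel. f (Complex u \<gamma>))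
           = 2 * pi * \<i> * (if \<alpha> < 0 \<and> 0 < \<gamma> then residue f 0 else 0)" (is "?A - ?B = ?r")
proof -
  let ?S = "{w. \<bar>Im w\<bar> < \<rho>}"
  have S: "open ?S" "convex ?S"
  proof -
    have *: "?S = {w. Im w < \<rho>} \<inter> {w. Im w > - \<rho>}" by auto
    show "open ?S" unfolding * by (intro open_Int open_halfspace_Im_lt open_halfspace_Im_gt)
    show "convex ?S" unfolding * by (intro convex_Int convex_halfspace_Im_lt convex_halfspace_Im_gt)
  qed
  have cont: "continuous_on (?S - {0}) f" using holo by (rule holomorphic_on_imp_continuous_on)
  define V where "V = (\<lambda>R. contour_integral (linepath (Complex R \<alpha>) (Complex R \<gamma>)) f)"
  have rect: "integral {-R..R} (\<lambda>u. f (Complex u \<alpha>)) - integral {-R..R} (\<lambda>u. f (Complex u \<gamma>))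
        + V R - V (-R) = ?r" if R: "R > 0" for R
  proof -
    let ?g = "rectpath (Complex (-R) \<alpha>) (Complex R \<gamma>)"
    have img: "path_image ?g \<subseteq> ?S - {0}"
      using lines R by (auto simp: path_image_rectpath)
    have "contour_integral ?g f = 2 * pi * \<i> * (\<Sum>q\<in>{0}. winding_number ?g q * residue f q)"
    proof (rule Residue_theorem[OF S(1) _ _ holo _ _ img])
      show "\<forall>z. z \<notin> ?S \<longrightarrow> winding_number ?g z = 0"
        using lines R by (auto intro!: winding_number_rectpath_outside simp: in_cbox_complex_iff)
    qed (use S(2) convex_connected in auto)
    also have "\<dots> = ?r"
    proof (cases "\<alpha> < 0 \<and> 0 < \<gamma>")
      case True
      then have "winding_number ?g 0 = 1"
        using R by (intro winding_number_rectpath) (auto simp: in_box_complex_iff)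
      then show ?thesis using True by simp
    next
      case False
      then have "winding_number ?g 0 = 0"
        using R lines by (intro winding_number_rectpath_outside) (auto simp: in_cbox_complex_iff)
      then show ?thesis by (simp only: if_not_P[OF False]) simp
    qed
    finally have 1: "contour_integral ?g f = ?r" .
    have seg: "closed_segment (Complex (-R) \<alpha>) (Complex R \<alpha>) \<subseteq> ?S - {0}"
         "closed_segment (Complex R \<alpha>) (Complex R \<gamma>) \<subseteq> ?S - {0}"
         "closed_segment (Complex R \<gamma>) (Complex (-R) \<gamma>) \<subseteq> ?S - {0}"
         "closed_segment (Complex (-R) \<gamma>) (Complex (-R) \<alpha>) \<subseteq> ?S - {0}"
      using img by (simp_all add: rectpath_def Let_def path_image_join)
    have ci: "f contour_integrable_on linepath (Complex (-R) \<alpha>) (Complex R \<alpha>)"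
         "f contour_integrable_on linepath (Complex R \<alpha>) (Complex R \<gamma>)"
         "f contour_integrable_on linepath (Complex R \<gamma>) (Complex (-R) \<gamma>)"
         "f contour_integrable_on linepath (Complex (-R) \<gamma>) (Complex (-R) \<alpha>)"
      using seg by (auto intro!: contour_integrable_continuous_linepath continuous_on_subset[OF cont])
    have hor: "contour_integral (linepath (Complex (-R) \<eta>) (Complex R \<eta>)) f
                 = integral {-R..R} (\<lambda>u. f (Complex u \<eta>))"
      if "f contour_integrable_on linepath (Complex (-R) \<eta>) (Complex R \<eta>)" for \<eta>
      using has_contour_integral_integral[OF that] R
      by (subst (asm) has_contour_integral_horizontal_iff) (auto dest!: integral_unique)
    have "contour_integral ?g f = contour_integral (linepath (Complex (-R) \<alpha>) (Complex R \<alpha>)) f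
        + contour_integral (linepath (Complex R \<alpha>) (Complex R \<gamma>)) f
        + contour_integral (linepath (Complex R \<gamma>) (Complex (-R) \<gamma>)) f
        + contour_integral (linepath (Complex (-R) \<gamma>) (Complex (-R) \<alpha>)) f"
      using ci by (simp add: rectpath_def Let_def add.assoc)
    moreover have "contour_integral (linepath (Complex R \<gamma>) (Complex (-R) \<gamma>)) f
        = - contour_integral (linepath (Complex (-R) \<gamma>) (Complex R \<gamma>)) f"
      using contour_integral_reversepath[of "linepath (Complex (-R) \<gamma>) (Complex R \<gamma>)" f] by simp
    moreover have "contour_integral (linepath (Complex (-R) \<gamma>) (Complex (-R) \<alpha>)) f = - V (-R)"
      using contour_integral_reversepath[of "linepath (Complex (-R) \<alpha>) (Complex (-R) \<gamma>)" f]
      by (simp add: V_def)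
    moreover have "f contour_integrable_on linepath (Complex (-R) \<gamma>) (Complex R \<gamma>)"
      using contour_integrable_reversepath[OF _ ci(3)] by simp
    ultimately show ?thesis
      using 1 ci(1) by (simp add: hor V_def algebra_simps)
  qed
  have C0: "C \<ge> 0"
  proof -
    have "norm (f (Complex \<bar>R0\<bar> \<alpha>)) \<le> C * exp (- \<delta> * \<bar>R0\<bar>)"
      using decay[of "Complex \<bar>R0\<bar> \<alpha>"] lines by simp
    then have "0 \<le> C * exp (- \<delta> * \<bar>R0\<bar>)"
      by (rule order_trans[OF norm_ge_zero])
    then show ?thesis by (simp add: zero_le_mult_iff)
  qed
  have Vb: "norm (V s) \<le> C * exp (- \<delta> * R) * (\<gamma> - \<alpha>)" if "R > 0" "R \<ge> R0" "s = R \<or> s = -R" for R s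
  proof -
    have seg: "w \<in> ?S - {0} \<and> \<bar>Re w\<bar> = R \<and> \<alpha> \<le> Im w \<and> Im w \<le> \<gamma>"
      if "w \<in> closed_segment (Complex s \<alpha>) (Complex s \<gamma>)" for w
      using that \<open>R > 0\<close> \<open>s = R \<or> s = -R\<close> lines
      by (auto simp: closed_segment_same_Re closed_segment_eq_real_ivl)
    have "norm (V s) \<le> C * exp (- \<delta> * R) * norm (Complex s \<gamma> - Complex s \<alpha>)"
      unfolding V_def
    proof (rule contour_integral_bound_linepath)
      show "f contour_integrable_on linepath (Complex s \<alpha>) (Complex s \<gamma>)"
        using seg by (intro contour_integrable_continuous_linepath continuous_on_subset[OF cont]) blast
      fix w assume "w \<in> closed_segment (Complex s \<alpha>) (Complex s \<gamma>)"
      from seg[OF this] show "norm (f w) \<le> C * exp (- \<delta> * R)"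
        using decay[of w] \<open>R \<ge> R0\<close> by auto
    qed (use C0 in auto)
    also have "norm (Complex s \<gamma> - Complex s \<alpha>) = \<gamma> - \<alpha>"
      using lines by (simp add: cmod_def)
    finally show ?thesis .
  qed
  have lim0: "(\<lambda>n. C * exp (- \<delta> * real n) * (\<gamma> - \<alpha>)) \<longlonglongrightarrow> 0"
  proof -
    have "(\<lambda>n. exp (- \<delta> * real n)) \<longlonglongrightarrow> 0"
      using \<open>\<delta> > 0\<close>
      by (intro filterlim_compose[OF exp_at_bot] filterlim_tendsto_neg_mult_at_bot[OF tendsto_const]
            filterlim_real_sequentially) auto
    from tendsto_mult_right[OF tendsto_mult_left[OF this, of C], of "\<gamma> - \<alpha>"] show ?thesis by simp
  qed
  have ev: "\<forall>\<^sub>F n in sequentially. real n > 0 \<and> real n \<ge> R0"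
    using eventually_gt_at_top[of 0] filterlim_real_sequentially[unfolded filterlim_at_top, rule_format, of R0]
    by eventually_elim auto
  have V1: "(\<lambda>n. V (real n)) \<longlonglongrightarrow> 0"
    by (rule Lim_null_comparison[OF _ lim0]) (use ev in \<open>eventually_elim, use Vb in simp\<close>)
  have V2: "(\<lambda>n. V (- real n)) \<longlonglongrightarrow> 0"
    by (rule Lim_null_comparison[OF _ lim0]) (use ev in \<open>eventually_elim, use Vb in simp\<close>)
  have "(\<lambda>n. integral {- real n..real n} (\<lambda>u. f (Complex u \<alpha>))
          - integral {- real n..real n} (\<lambda>u. f (Complex u \<gamma>)) + V (real n) - V (- real n))
        \<longlonglongrightarrow> ?A - ?B + 0 - 0"
    by (intro tendsto_intros lborel_integral_symmetric_interval_tendsto int V1 V2)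
  moreover have "(\<lambda>n. integral {- real n..real n} (\<lambda>u. f (Complex u \<alpha>))
          - integral {- real n..real n} (\<lambda>u. f (Complex u \<gamma>)) + V (real n) - V (- real n))
        \<longlonglongrightarrow> ?r"
    by (rule tendsto_eventually) (use ev in \<open>eventually_elim, use rect in simp\<close>)
  ultimately show ?thesis using LIMSEQ_unique by fastforce
qed

section \<open>The integrand of the quantum dilogarithm\<close>

lemma integrable_exp_neg_abs:
  assumes "\<delta> > 0"
  shows "integrable lborel (\<lambda>u::real. exp (- \<delta> * \<bar>u\<bar>))"
proof -
  have half: "integrable lborel (\<lambda>u. indicator {0..} u * exp (- \<delta> * \<bar>u\<bar>))"
  proof -
    have "(\<lambda>u::real. exp (- \<delta> * u)) integrable_on {0..}"
      using has_integral_exp_minus_to_infinity[OF assms, of 0] by (auto simp: integrable_on_def)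
    then have "(\<lambda>u::real. exp (- \<delta> * u)) absolutely_integrable_on {0..}"
      by (rule nonnegative_absolutely_integrable_1) auto
    then have "integrable lebesgue (\<lambda>u::real. indicator {0..} u * exp (- \<delta> * \<bar>u\<bar>))"
      unfolding set_integrable_def
      by (rule Bochner_Integration.integrable_cong[THEN iffD1, rotated -1]) (auto simp: indicator_def)
    then show ?thesis by (subst (asm) integrable_completion) auto
  qed
  have "integrable lborel (\<lambda>u. indicator {0..} u * exp (- \<delta> * \<bar>u\<bar>)
          + indicator {0..} (0 + (- 1) * u) * exp (- \<delta> * \<bar>0 + (- 1) * u\<bar>))"
    by (intro Bochner_Integration.integrable_add half lborel_integrable_real_affine[OF half]) auto
  then show ?thesis
    by (rule Bochner_Integration.integrable_bound) (auto simp: indicator_def)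
qed

lemma Re_sinh: "Re (sinh z) = sinh (Re z) * cos (Im z)"
  and Im_sinh: "Im (sinh z) = cosh (Re z) * sin (Im z)"
  by (simp_all add: sinh_field_def cosh_field_def Re_exp Im_exp field_simps)

text \<open>
  Two lower bounds are needed: this one holds on a whole horizontal line away from the zeros, while
  the next one is uniform in the imaginary part and therefore usable on the vertical sides of
  rectangles that surround the pole at \<open>0\<close>.
\<close>

lemma norm_sinh_ge_exp_sin: "exp \<bar>Re z\<bar> / 2 * \<bar>sin (Im z)\<bar> \<le> norm (sinh z)"
proof -
  have "exp \<bar>Re z\<bar> / 2 \<le> cosh (Re z)"
    by (auto simp: cosh_field_def abs_if)
  then have "exp \<bar>Re z\<bar> / 2 * \<bar>sin (Im z)\<bar> \<le> \<bar>Im (sinh z)\<bar>"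
    using mult_right_mono[of "exp \<bar>Re z\<bar> / 2" "cosh (Re z)" "\<bar>sin (Im z)\<bar>"]
    by (simp add: Im_sinh abs_mult)
  then show ?thesis using abs_Im_le_cmod[of "sinh z"] by linarith
qed

lemma norm_sinh_ge_exp:
  assumes "\<bar>Re z\<bar> \<ge> 1"
  shows "exp \<bar>Re z\<bar> / 4 \<le> norm (sinh z)"
proof -
  let ?x = "\<bar>Re z\<bar>"
  have "exp (2 * ?x) \<ge> 1 + 2 * ?x" by (rule exp_ge_add_one_self)
  moreover have "exp ?x * exp ?x = exp (2 * ?x)" by (simp add: mult_exp_exp)
  ultimately have "exp ?x * exp ?x \<ge> 2" using assms by linarith
  then have "exp ?x \<ge> 2 * exp (- ?x)" by (simp add: exp_minus field_simps)
  then have "exp ?x / 4 \<le> sinh ?x" unfolding sinh_field_def by simp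
  then have 1: "exp ?x / 4 \<le> \<bar>sinh (Re z)\<bar>" by (auto simp: abs_if split: if_splits)
  have "(sinh (Re z))\<^sup>2 \<le> (norm (sinh z))\<^sup>2"
  proof -
    have "(norm (sinh z))\<^sup>2 = (sinh (Re z))\<^sup>2 * (cos (Im z))\<^sup>2 + (1 + (sinh (Re z))\<^sup>2) * (sin (Im z))\<^sup>2"
      by (simp add: cmod_power2 Re_sinh Im_sinh power_mult_distrib cosh_square_eq add.commute)
    also have "\<dots> = (sinh (Re z))\<^sup>2 * ((sin (Im z))\<^sup>2 + (cos (Im z))\<^sup>2) + (sin (Im z))\<^sup>2"
      by (simp only: distrib_left distrib_right mult_1_left add_ac)
    finally show ?thesis by simp
  qed
  then have "\<bar>sinh (Re z)\<bar> \<le> norm (sinh z)" by (metis norm_ge_zero power2_abs power2_le_imp_le)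
  with 1 show ?thesis by linarith
qed

lemma sinh_eq_0_strip:
  assumes "sinh (z::complex) = 0" "\<bar>Im z\<bar> < pi"
  shows "z = 0"
proof -
  have "sin (Im z) = 0" using assms(1) Im_sinh[of z] cosh_real_nonzero[of "Re z"] by simp
  then have "Im z = 0" using assms(2) sin_gt_zero[of "Im z"] sin_gt_zero[of "- Im z"] by fastforce
  moreover from this have "Re z = 0" using assms(1) Re_sinh[of z] by simp
  ultimately show ?thesis by (simp add: complex_eq_iff)
qed

text \<open>
  The entire function with \<open>sinh w = w * sinhc w\<close>; dividing it out exhibits the pole at \<open>0\<close> of the
  dilogarithm integrand as an explicit factor \<open>w\<^sup>-\<^sup>3\<close>.
\<close>

definition sinhc :: "complex \<Rightarrow> complex" where
  "sinhc w = (if w = 0 then 1 else sinh w / w)"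

lemma sinhc_holomorphic: "sinhc holomorphic_on UNIV"
proof -
  have "((\<lambda>w. sinh w / w) \<longlongrightarrow> 1) (at (0::complex))"
  proof -
    have "(sinh has_field_derivative cosh 0) (at (0::complex))" by (auto intro!: derivative_eq_intros)
    then show ?thesis by (simp add: has_field_derivative_iff)
  qed
  then have "(\<lambda>w::complex. if w = 0 then 1 else sinh w / w) holomorphic_on UNIV"
    by (intro removable_singularity) (auto intro!: holomorphic_intros simp: sinh_def)
  then show ?thesis by (simp add: sinhc_def[abs_def])
qed

definition dilog_integrand :: "real \<Rightarrow> complex \<Rightarrow> complex \<Rightarrow> complex" where
  "dilog_integrand \<beta> z w =
     exp (- 2 * \<i> * z * w) / (sinh (of_real \<beta> * w) * sinh (of_real (1 / \<beta>) * w) * w)"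

definition dilog_line :: "real \<Rightarrow> complex \<Rightarrow> real \<Rightarrow> complex" where
  "dilog_line \<beta> z \<eta> = (LINT u|lborel. dilog_integrand \<beta> z (Complex u \<eta>))"

lemma dilog_integrand_nonzero_denominator:
  assumes "\<beta> > 0" "\<bar>Im w\<bar> < pi * min \<beta> (1 / \<beta>)" "w \<noteq> 0"
  shows "sinh (of_real \<beta> * w) \<noteq> 0" "sinh (of_real (1 / \<beta>) * w) \<noteq> 0"
proof -
  have "pi * min \<beta> (1 / \<beta>) \<le> pi * (1 / \<beta>)" "pi * min \<beta> (1 / \<beta>) \<le> pi * \<beta>"
    by (intro mult_left_mono; simp)+
  then have "\<bar>Im w\<bar> < pi * (1 / \<beta>)" "\<bar>Im w\<bar> < pi * \<beta>"
    using assms(2) by linarith+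
  then have "\<bar>Im (of_real \<beta> * w)\<bar> < pi" "\<bar>Im (of_real (1 / \<beta>) * w)\<bar> < pi"
    using \<open>\<beta> > 0\<close> by (auto simp: abs_mult field_simps)
  then show "sinh (of_real \<beta> * w) \<noteq> 0" "sinh (of_real (1 / \<beta>) * w) \<noteq> 0"
    using sinh_eq_0_strip[of "of_real \<beta> * w"] sinh_eq_0_strip[of "of_real (1 / \<beta>) * w"] assms by auto
qed

lemma dilog_integrand_holomorphic:
  assumes "\<beta> > 0"
  shows "dilog_integrand \<beta> z holomorphic_on {w. \<bar>Im w\<bar> < pi * min \<beta> (1 / \<beta>)} - {0}"
proof -
  have *: "sinh w = (exp w - exp (- w)) / 2" for w :: complex by (simp add: sinh_field_def)
  show ?thesis
    unfolding dilog_integrand_def[abs_def]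
    using dilog_integrand_nonzero_denominator[OF assms]
    by (intro holomorphic_intros) (auto simp: * intro!: holomorphic_intros)
qed

text \<open>
  The integrand is \<open>exp (-2 i z w) G(w) / w\<^sup>3\<close> with \<open>G\<close> holomorphic and even, \<open>G(0) = 1\<close>.  Evenness
  kills the term linear in \<open>z\<close>, and the second coefficient \<open>C\<close> of \<open>G\<close> does not depend on \<open>z\<close>.
\<close>

lemma residue_dilog_integrand:
  assumes "\<beta> > 0"
  shows "\<exists>C. \<forall>z. residue (dilog_integrand \<beta> z) 0 = C - 2 * z\<^sup>2"
proof -
  define G where "G = (\<lambda>w. 1 / (sinhc (of_real \<beta> * w) * sinhc (of_real (1 / \<beta>) * w)))"
  have eq: "dilog_integrand \<beta> z = (\<lambda>w. exp (- 2 * \<i> * z * w) * G w / w ^ Suc 2)" for z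
    using assms by (auto simp: fun_eq_iff dilog_integrand_def G_def sinhc_def power3_eq_cube numeral_3_eq_3)
  have "sinhc analytic_on UNIV" using sinhc_holomorphic by (simp add: analytic_on_open)
  then have an: "(\<lambda>w. sinhc (c * w)) analytic_on {0}" for c
    using analytic_on_compose_gen[of "\<lambda>w. c * w" "{0}" sinhc UNIV]
    by (auto simp: o_def intro!: analytic_intros)
  have G0: "G 0 = 1" by (simp add: G_def sinhc_def)
  have "G analytic_on {0}"
    unfolding G_def by (intro analytic_intros an) (simp add: sinhc_def)
  then obtain F where F: "G has_fps_expansion F" using analytic_at_imp_has_fps_expansion_0 by blast
  have even: "G (- w) = G w" for w by (simp add: G_def sinhc_def)
  have F0: "fps_nth F 0 = 1" using F G0 has_fps_expansion_imp_0_eq_fps_nth_0 by metis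
  have F1: "fps_nth F 1 = 0"
  proof -
    have "(G \<circ> (\<lambda>w. - w)) has_fps_expansion fps_compose F (- fps_X)"
      by (intro has_fps_expansion_compose F has_fps_expansion_minus has_fps_expansion_fps_X) auto
    then have "fps_compose F (- fps_X) = F"
      using F even by (metis (no_types, lifting) comp_apply ext fps_expansion_unique_complex)
    then have "fps_nth (fps_compose F (- fps_X)) 1 = fps_nth F 1" by simp
    then show ?thesis by (simp add: fps_compose_nth)
  qed
  have "residue (dilog_integrand \<beta> z) 0 = fps_nth F 2 - 2 * z\<^sup>2" for z
  proof -
    have "(\<lambda>w. exp (- 2 * \<i> * z * w) * G w) has_fps_expansion fps_exp (- 2 * \<i> * z) * F"
      by (intro has_fps_expansion_mult has_fps_expansion_exp F)
    from residue_fps_expansion_over_power_at_0[OF this, of 2]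
    show ?thesis unfolding eq using F0 F1
      by (simp add: fps_mult_nth numeral_2_eq_2 power_mult_distrib)
  qed
  then show ?thesis by blast
qed

section \<open>Growth of the quantum dilogarithm on horizontal lines\<close>

lemma dilog_integrand_factor:
  "dilog_integrand \<beta> z w = exp (- 2 * \<i> * z * w) * dilog_integrand \<beta> 0 w"
  by (simp add: dilog_integrand_def)

lemma norm_exp_dilog: "norm (exp (- 2 * \<i> * z * w)) = exp (2 * (Re z * Im w + Im z * Re w))"
  by (simp add: norm_exp_eq_Re algebra_simps)

lemma exp_neg_sum: "exp (- (a + b) * v) = 1 / (exp (a * v) * exp (b * v))" for a b v :: real
  by (simp only: mult_minus_left exp_minus inverse_eq_divide mult_exp_exp distrib_right)

lemma dilog_integrand_line_bound:
  assumes "\<beta> > 0" "\<eta> \<noteq> 0" "\<bar>\<eta>\<bar> < pi * min \<beta> (1 / \<beta>)"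
  shows "\<exists>K\<ge>0. \<forall>z u. norm (dilog_integrand \<beta> z (Complex u \<eta>))
           \<le> exp (2 * (Re z * \<eta> + Im z * u)) * (K * exp (- (\<beta> + 1 / \<beta>) * \<bar>u\<bar>))"
proof -
  define s1 s2 where "s1 = \<bar>sin (\<beta> * \<eta>)\<bar>" and "s2 = \<bar>sin (1 / \<beta> * \<eta>)\<bar>"
  have "pi * min \<beta> (1 / \<beta>) \<le> pi * (1 / \<beta>)" "pi * min \<beta> (1 / \<beta>) \<le> pi * \<beta>"
    by (intro mult_left_mono; simp)+
  then have "\<bar>\<eta>\<bar> < pi * (1 / \<beta>)" "\<bar>\<eta>\<bar> < pi * \<beta>" using assms(3) by linarith+
  then have b: "\<bar>\<beta> * \<eta>\<bar> < pi" "\<bar>1 / \<beta> * \<eta>\<bar> < pi"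
    using \<open>\<beta> > 0\<close> by (simp_all add: abs_mult field_simps)
  have sin0: "sin x \<noteq> 0" if "x \<noteq> 0" "\<bar>x\<bar> < pi" for x :: real
    using that sin_gt_zero[of x] sin_gt_zero[of "- x"] by fastforce
  have pos: "s1 > 0" "s2 > 0"
    using sin0[OF _ b(1)] sin0[OF _ b(2)] assms by (auto simp: s1_def s2_def)
  define K where "K = 4 / (s1 * s2 * \<bar>\<eta>\<bar>)"
  show ?thesis
  proof (intro exI[of _ K] conjI allI)
    show "K \<ge> 0" using pos by (simp add: K_def)
    fix z u
    let ?w = "Complex u \<eta>"
    have "(exp (\<beta> * \<bar>u\<bar>) / 2 * s1) * (exp (1 / \<beta> * \<bar>u\<bar>) / 2 * s2) * \<bar>\<eta>\<bar>
        \<le> norm (sinh (of_real \<beta> * ?w)) * norm (sinh (of_real (1 / \<beta>) * ?w)) * norm ?w"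
      using norm_sinh_ge_exp_sin[of "of_real \<beta> * ?w"] norm_sinh_ge_exp_sin[of "of_real (1 / \<beta>) * ?w"]
        abs_Im_le_cmod[of ?w] pos \<open>\<beta> > 0\<close>
      by (intro mult_mono) (simp_all add: abs_mult s1_def s2_def)
    then have "norm (dilog_integrand \<beta> z ?w) \<le> exp (2 * (Re z * \<eta> + Im z * u)) /
        ((exp (\<beta> * \<bar>u\<bar>) / 2 * s1) * (exp (1 / \<beta> * \<bar>u\<bar>) / 2 * s2) * \<bar>\<eta>\<bar>)"
      using pos assms(2)
      unfolding dilog_integrand_def norm_divide norm_mult norm_exp_dilog
      by (intro frac_le) simp_all
    also have "\<dots> = exp (2 * (Re z * \<eta> + Im z * u)) * (K * exp (- (\<beta> + 1 / \<beta>) * \<bar>u\<bar>))"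
      using pos assms(2) unfolding exp_neg_sum by (simp add: K_def field_simps)
    finally show "norm (dilog_integrand \<beta> z ?w) \<le> \<dots>" .
  qed
qed

lemma dilog_integrand_decay:
  assumes "\<beta> > 0" "max 1 (max \<beta> (1 / \<beta>)) \<le> \<bar>Re w\<bar>"
  shows "norm (dilog_integrand \<beta> z w)
           \<le> exp (2 * (Re z * Im w + Im z * Re w)) * (16 * exp (- (\<beta> + 1 / \<beta>) * \<bar>Re w\<bar>))"
proof -
  let ?u = "\<bar>Re w\<bar>"
  have ge: "\<beta> * ?u \<ge> 1" "1 / \<beta> * ?u \<ge> 1" "?u \<ge> 1"
    using assms by (auto simp: field_simps)
  have "(exp (\<beta> * ?u) / 4) * (exp (1 / \<beta> * ?u) / 4) * 1
      \<le> norm (sinh (of_real \<beta> * w)) * norm (sinh (of_real (1 / \<beta>) * w)) * norm w"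
    using norm_sinh_ge_exp[of "of_real \<beta> * w"] norm_sinh_ge_exp[of "of_real (1 / \<beta>) * w"]
      abs_Re_le_cmod[of w] ge \<open>\<beta> > 0\<close>
    by (intro mult_mono) (simp_all add: abs_mult)
  then have "norm (dilog_integrand \<beta> z w) \<le> exp (2 * (Re z * Im w + Im z * Re w)) /
      ((exp (\<beta> * ?u) / 4) * (exp (1 / \<beta> * ?u) / 4) * 1)"
    unfolding dilog_integrand_def norm_divide norm_mult norm_exp_dilog
    by (intro frac_le) simp_all
  also have "\<dots> = exp (2 * (Re z * Im w + Im z * Re w)) * (16 * exp (- (\<beta> + 1 / \<beta>) * ?u))"
    unfolding exp_neg_sum by (simp add: field_simps)
  finally show ?thesis .
qed

lemma dilog_exponent_le:
  "exp (2 * (A + y * u)) * (K * exp (- Q * \<bar>u\<bar>)) \<le> exp (2 * A) * (K * exp (- (Q - 2 * \<bar>y\<bar>) * \<bar>u\<bar>))"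
  if "K \<ge> 0" for y u Q K A :: real
proof -
  have "y * u \<le> \<bar>y\<bar> * \<bar>u\<bar>" by (metis abs_ge_self abs_mult)
  then have "exp (2 * (A + y * u) + - Q * \<bar>u\<bar>) \<le> exp (2 * A + - (Q - 2 * \<bar>y\<bar>) * \<bar>u\<bar>)"
    by (simp add: algebra_simps)
  from mult_left_mono[OF this that] show ?thesis
    unfolding exp_add by (simp only: mult_ac)
qed

lemma dilog_integrand_line_measurable:
  assumes "\<beta> > 0" "\<eta> \<noteq> 0" "\<bar>\<eta>\<bar> < pi * min \<beta> (1 / \<beta>)"
  shows "(\<lambda>u. dilog_integrand \<beta> z (Complex u \<eta>)) \<in> borel_measurable borel"
proof (rule borel_measurable_continuous_onI)
  show "continuous_on UNIV (\<lambda>u. dilog_integrand \<beta> z (Complex u \<eta>))"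
    using assms
    by (intro continuous_on_compose2[OF holomorphic_on_imp_continuous_on[OF dilog_integrand_holomorphic]])
       (auto simp: Complex_eq complex_eq_iff intro!: continuous_intros)
qed

lemma dilog_integrand_line_integrable:
  assumes "\<beta> > 0" "\<eta> \<noteq> 0" "\<bar>\<eta>\<bar> < pi * min \<beta> (1 / \<beta>)" "2 * \<bar>Im z\<bar> < \<beta> + 1 / \<beta>"
  shows "integrable lborel (\<lambda>u. dilog_integrand \<beta> z (Complex u \<eta>))"
proof -
  obtain K where K: "K \<ge> 0" "\<And>u. norm (dilog_integrand \<beta> z (Complex u \<eta>))
           \<le> exp (2 * (Re z * \<eta> + Im z * u)) * (K * exp (- (\<beta> + 1 / \<beta>) * \<bar>u\<bar>))"
    using dilog_integrand_line_bound[OF assms(1-3)] by blast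
  show ?thesis
  proof (rule Bochner_Integration.integrable_bound)
    show "integrable lborel (\<lambda>u. exp (2 * (Re z * \<eta>)) * (K * exp (- (\<beta> + 1 / \<beta> - 2 * \<bar>Im z\<bar>) * \<bar>u\<bar>)))"
      using assms(4) by (intro integrable_mult_right integrable_exp_neg_abs) auto
    show "(\<lambda>u. dilog_integrand \<beta> z (Complex u \<eta>)) \<in> borel_measurable lborel"
      using dilog_integrand_line_measurable[OF assms(1-3)] by simp
    show "AE u in lborel. norm (dilog_integrand \<beta> z (Complex u \<eta>))
        \<le> norm (exp (2 * (Re z * \<eta>)) * (K * exp (- (\<beta> + 1 / \<beta> - 2 * \<bar>Im z\<bar>) * \<bar>u\<bar>)))"
      using order_trans[OF K(2) dilog_exponent_le[OF K(1)]] K(1) by (intro AE_I2) (simp add: abs_mult)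
  qed
qed

text \<open>
  The modulus of the integrand depends on the real part \<open>t\<close> of \<open>z\<close> only through the factor \<open>exp (2 t \<eta>)\<close>: a line above the pole gives
  a bounded integral for \<open>t \<le> 0\<close>, a line below it for \<open>t \<ge> 0\<close>.
\<close>

lemma dilog_line_bound:
  assumes "\<beta> > 0" "\<eta> \<noteq> 0" "\<bar>\<eta>\<bar> < pi * min \<beta> (1 / \<beta>)" "2 * \<bar>y\<bar> < \<beta> + 1 / \<beta>"
  shows "\<exists>M. \<forall>t. norm (dilog_line \<beta> (Complex t y) \<eta>) \<le> exp (2 * (t * \<eta>)) * M"
proof -
  obtain K where K: "K \<ge> 0" "\<And>z u. norm (dilog_integrand \<beta> z (Complex u \<eta>))
           \<le> exp (2 * (Re z * \<eta> + Im z * u)) * (K * exp (- (\<beta> + 1 / \<beta>) * \<bar>u\<bar>))"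
    using dilog_integrand_line_bound[OF assms(1-3)] by blast
  define h where "h = (\<lambda>u. K * exp (- (\<beta> + 1 / \<beta> - 2 * \<bar>y\<bar>) * \<bar>u\<bar>))"
  have h: "integrable lborel h"
    unfolding h_def using assms(4) by (intro integrable_mult_right integrable_exp_neg_abs) auto
  have "norm (dilog_line \<beta> (Complex t y) \<eta>) \<le> exp (2 * (t * \<eta>)) * (LINT u|lborel. h u)" for t
  proof -
    have "norm (dilog_line \<beta> (Complex t y) \<eta>) \<le> (LINT u|lborel. norm (dilog_integrand \<beta> (Complex t y) (Complex u \<eta>)))"
      unfolding dilog_line_def by (rule integral_norm_bound)
    also have "\<dots> \<le> (LINT u|lborel. exp (2 * (t * \<eta>)) * h u)"
    proof (rule integral_mono)
      show "integrable lborel (\<lambda>u. norm (dilog_integrand \<beta> (Complex t y) (Complex u \<eta>)))"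
        using assms by (intro integrable_norm dilog_integrand_line_integrable) auto
      show "integrable lborel (\<lambda>u. exp (2 * (t * \<eta>)) * h u)" using h by simp
      show "norm (dilog_integrand \<beta> (Complex t y) (Complex u \<eta>)) \<le> exp (2 * (t * \<eta>)) * h u" for u
        using order_trans[OF K(2) dilog_exponent_le[OF K(1)], of "Complex t y" u] by (simp add: h_def)
    qed
    finally show ?thesis by simp
  qed
  then show ?thesis by blast
qed

lemma dilog_line_shift:
  assumes "\<beta> > 0" "\<alpha> < \<gamma>" "\<alpha> \<noteq> 0" "\<gamma> \<noteq> 0" "\<bar>\<alpha>\<bar> < pi * min \<beta> (1 / \<beta>)" "\<bar>\<gamma>\<bar> < pi * min \<beta> (1 / \<beta>)"
    "2 * \<bar>Im z\<bar> < \<beta> + 1 / \<beta>"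
  shows "dilog_line \<beta> z \<alpha> - dilog_line \<beta> z \<gamma>
     = 2 * pi * \<i> * (if \<alpha> < 0 \<and> 0 < \<gamma> then residue (dilog_integrand \<beta> z) 0 else 0)"
  unfolding dilog_line_def
proof (rule strip_contour_shift[OF dilog_integrand_holomorphic[OF assms(1)]])
  fix w :: complex
  assume w: "max 1 (max \<beta> (1 / \<beta>)) \<le> \<bar>Re w\<bar>" "\<alpha> \<le> Im w" "Im w \<le> \<gamma>"
  have "Re z * Im w \<le> \<bar>Re z\<bar> * (\<bar>\<alpha>\<bar> + \<bar>\<gamma>\<bar>)"
  proof -
    have "\<bar>Im w\<bar> \<le> \<bar>\<alpha>\<bar> + \<bar>\<gamma>\<bar>" using w by linarith
    then have "\<bar>Re z\<bar> * \<bar>Im w\<bar> \<le> \<bar>Re z\<bar> * (\<bar>\<alpha>\<bar> + \<bar>\<gamma>\<bar>)" by (intro mult_left_mono) auto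
    then show ?thesis by (metis abs_ge_self abs_mult order_trans)
  qed
  then have "exp (2 * (Re z * Im w)) * (16 * exp (- (\<beta> + 1 / \<beta> - 2 * \<bar>Im z\<bar>) * \<bar>Re w\<bar>))
      \<le> exp (2 * (\<bar>Re z\<bar> * (\<bar>\<alpha>\<bar> + \<bar>\<gamma>\<bar>))) * (16 * exp (- (\<beta> + 1 / \<beta> - 2 * \<bar>Im z\<bar>) * \<bar>Re w\<bar>))"
    by (intro mult_right_mono) auto
  with dilog_integrand_decay[OF assms(1) w(1), of z]
    dilog_exponent_le[of 16 "Re z * Im w" "Im z" "Re w" "\<beta> + 1 / \<beta>"]
  show "norm (dilog_integrand \<beta> z w)
      \<le> exp (2 * (\<bar>Re z\<bar> * (\<bar>\<alpha>\<bar> + \<bar>\<gamma>\<bar>))) * 16 * exp (- (\<beta> + 1 / \<beta> - 2 * \<bar>Im z\<bar>) * \<bar>Re w\<bar>)"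
    unfolding mult.assoc by linarith
qed (use assms in \<open>auto intro!: dilog_integrand_line_integrable\<close>)

lemma sqrt_hbar:
  assumes "\<beta> > 0"
  shows "sqrt (hbar \<beta>) = 1 / (\<beta> + 1 / \<beta>)"
  using assms by (auto simp: hbar_def real_sqrt_divide)

text \<open>
  Inside the strip the limit \<open>\<eta> \<rightarrow> 0+\<close> is the limit of a constant, since the line integrals do not depend
  on \<open>\<eta>\<close> as long as no zero of the denominator is crossed.
\<close>

lemma quantum_dilog_eq_line:
  assumes "\<beta> > 0" "2 * \<bar>Im z\<bar> < \<beta> + 1 / \<beta>" "0 < \<eta>" "\<eta> < pi * min \<beta> (1 / \<beta>)"
  shows "quantum_dilog \<beta> z = exp (1 / 4 * dilog_line \<beta> z \<eta>)"
proof -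
  have strip: "z \<in> dilog_strip \<beta>"
    using assms by (simp add: dilog_strip_def sqrt_hbar)
  have const: "dilog_line \<beta> z \<eta>' = dilog_line \<beta> z \<eta>" if "0 < \<eta>'" "\<eta>' < pi * min \<beta> (1 / \<beta>)" for \<eta>'
    using dilog_line_shift[OF assms(1), of \<eta>' \<eta> z] dilog_line_shift[OF assms(1), of \<eta> \<eta>' z] that assms
    by (cases \<eta> \<eta>' rule: linorder_cases) auto
  have ev: "\<forall>\<^sub>F \<eta>' in at_right (0::real). \<eta>' \<in> {0<..<pi * min \<beta> (1 / \<beta>)}"
    using assms by (intro eventually_at_right_real) auto
  have "Lim (at_right 0) (dilog_line \<beta> z) = dilog_line \<beta> z \<eta>"
    using ev const by (intro tendsto_Lim tendsto_eventually) (auto elim: eventually_mono)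
  moreover have "dilog_line \<beta> z = (\<lambda>\<eta>::real. LINT u|lborel.
       (let w = complex_of_real u + \<i> * complex_of_real \<eta>
        in exp (- 2 * \<i> * z * w)
             / (sinh (complex_of_real \<beta> * w) * sinh (complex_of_real (1 / \<beta>) * w) * w)))"
    by (simp add: dilog_line_def dilog_integrand_def Let_def Complex_eq fun_eq_iff)
  ultimately show ?thesis
    using strip by (simp add: quantum_dilog_def quantum_dilog_strip_def)
qed

text \<open>
  For \<open>t > 0\<close> the contour is moved below the pole.  The residue \<open>C - 2 z\<^sup>2\<close> contributes the factor
  \<open>exp (i \<pi> z\<^sup>2)\<close>, of modulus \<open>exp (-2 \<pi> t y)\<close>, and a constant.  One two-sided estimate of the logarithm
  controls both \<open>\<Phi>\<^sub>b\<close> and its inverse.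
\<close>

lemma ln_norm_quantum_dilog_asymptotics:
  assumes "\<beta> > 0" "2 * \<bar>y\<bar> < \<beta> + 1 / \<beta>"
  shows "\<exists>K. \<forall>t. \<bar>ln (norm (quantum_dilog \<beta> (Complex t y))) + 2 * pi * y * max t 0\<bar> \<le> K"
proof -
  \<comment> \<open>any height below the first zeros \<open>i \<pi> / \<beta>\<close>, \<open>i \<pi> \<beta>\<close> of the two hyperbolic sines\<close>
  define \<eta> where "\<eta> = pi * min \<beta> (1 / \<beta>) / 2"
  have \<eta>: "0 < \<eta>" "\<eta> < pi * min \<beta> (1 / \<beta>)" using \<open>\<beta> > 0\<close> by (auto simp: \<eta>_def)
  obtain M1 where M1: "\<And>t. norm (dilog_line \<beta> (Complex t y) \<eta>) \<le> exp (2 * (t * \<eta>)) * M1"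
    using dilog_line_bound[of \<beta> \<eta> y] assms \<eta> by auto
  obtain M2 where M2: "\<And>t. norm (dilog_line \<beta> (Complex t y) (- \<eta>)) \<le> exp (2 * (t * - \<eta>)) * M2"
    using dilog_line_bound[of \<beta> "- \<eta>" y] assms \<eta> by auto
  have M0: "M1 \<ge> 0" "M2 \<ge> 0" using order_trans[OF norm_ge_zero M1[of 0]] order_trans[OF norm_ge_zero M2[of 0]] by auto
  obtain C where C: "\<And>z. residue (dilog_integrand \<beta> z) 0 = C - 2 * z\<^sup>2"
    using residue_dilog_integrand[OF assms(1)] by blast
  have ln_eq: "ln (norm (quantum_dilog \<beta> (Complex t y))) = Re (dilog_line \<beta> (Complex t y) \<eta>) / 4" for t
    using quantum_dilog_eq_line[OF assms(1), of "Complex t y" \<eta>] assms(2) \<eta> by (simp add: norm_exp_eq_Re)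
  have "\<bar>ln (norm (quantum_dilog \<beta> (Complex t y))) + 2 * pi * y * max t 0\<bar> \<le> M1 + M2 + \<bar>pi / 2 * Im C\<bar>" for t
  proof (cases "t \<le> 0")
    case True
    then have "exp (2 * (t * \<eta>)) * M1 \<le> 1 * M1"
      using M0 \<eta> by (intro mult_right_mono) (auto simp: mult_nonneg_nonpos)
    then have "norm (dilog_line \<beta> (Complex t y) \<eta>) \<le> M1" using M1[of t] by simp
    then show ?thesis
      using True M0 abs_Re_le_cmod[of "dilog_line \<beta> (Complex t y) \<eta>"] by (simp add: ln_eq max_def)
  next
    case False
    then have "exp (2 * (t * - \<eta>)) * M2 \<le> 1 * M2"
      using M0 \<eta> by (intro mult_right_mono) auto
    then have "norm (dilog_line \<beta> (Complex t y) (- \<eta>)) \<le> M2" using M2[of t] by simp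
    then have "\<bar>Re (dilog_line \<beta> (Complex t y) (- \<eta>))\<bar> \<le> M2"
      using abs_Re_le_cmod order_trans by blast
    moreover have shift: "dilog_line \<beta> (Complex t y) \<eta> = dilog_line \<beta> (Complex t y) (- \<eta>)
        - 2 * pi * \<i> * (C - 2 * (Complex t y)\<^sup>2)"
      using dilog_line_shift[OF assms(1), of "- \<eta>" \<eta> "Complex t y"] \<eta> assms(2) by (simp add: C algebra_simps)
    have "Re (dilog_line \<beta> (Complex t y) \<eta>) = Re (dilog_line \<beta> (Complex t y) (- \<eta>))
        + 2 * pi * Im C - 8 * pi * y * t"
      unfolding shift by (simp add: power2_eq_square algebra_simps)
    then have "ln (norm (quantum_dilog \<beta> (Complex t y))) + 2 * pi * y * max t 0
        = Re (dilog_line \<beta> (Complex t y) (- \<eta>)) / 4 + pi / 2 * Im C"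
      using False by (simp add: ln_eq max_def field_simps)
    ultimately show ?thesis using M0 by linarith
  qed
  then show ?thesis by blast
qed

lemma quantum_dilog_nonzero:
  assumes "\<beta> > 0" "2 * \<bar>Im z\<bar> < \<beta> + 1 / \<beta>"
  shows "quantum_dilog \<beta> z \<noteq> 0"
  using quantum_dilog_eq_line[OF assms, of "pi * min \<beta> (1 / \<beta>) / 2"] assms(1) by simp

lemma quantum_dilog_line_measurable:
  assumes "\<beta> > 0" "2 * \<bar>y\<bar> < \<beta> + 1 / \<beta>"
  shows "(\<lambda>t. quantum_dilog \<beta> (Complex t y)) \<in> borel_measurable borel"
proof -
  define \<eta> where "\<eta> = pi * min \<beta> (1 / \<beta>) / 2"
  have \<eta>: "0 < \<eta>" "\<eta> < pi * min \<beta> (1 / \<beta>)" using \<open>\<beta> > 0\<close> by (auto simp: \<eta>_def)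
  have [measurable]: "(\<lambda>u. dilog_integrand \<beta> 0 (Complex u \<eta>)) \<in> borel_measurable borel"
    using dilog_integrand_line_measurable \<eta> assms(1) by simp
  have "(\<lambda>t. exp (1 / 4 * (LINT u|lborel. exp (- 2 * \<i> * (of_real t + \<i> * of_real y) * (of_real u + \<i> * of_real \<eta>))
          * dilog_integrand \<beta> 0 (Complex u \<eta>)))) \<in> borel_measurable borel"
    by measurable
  also have "(\<lambda>t. exp (1 / 4 * (LINT u|lborel. exp (- 2 * \<i> * (of_real t + \<i> * of_real y) * (of_real u + \<i> * of_real \<eta>))
          * dilog_integrand \<beta> 0 (Complex u \<eta>)))) = (\<lambda>t. quantum_dilog \<beta> (Complex t y))"
    using quantum_dilog_eq_line[OF assms(1) _ \<eta>] assms(2)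
    by (simp add: dilog_line_def dilog_integrand_factor[of \<beta> "Complex _ _"] Complex_eq[symmetric])
  finally show ?thesis .
qed

section \<open>Unimodularity of the delta matrix\<close>

lemma det_Ints:
  fixes A :: "real mat"
  assumes "A \<in> carrier_mat n n" "\<And>i j. i < n \<Longrightarrow> j < n \<Longrightarrow> A $$ (i, j) \<in> \<int>"
  shows "Determinant.det A \<in> \<int>"
proof -
  have "signof q * (\<Prod>i = 0..<n. A $$ (i, q i)) \<in> \<int>" if "q permutes {0..<n}" for q
  proof (intro Ints_mult Ints_prod)
    show "signof q \<in> (\<int> :: real set)" by (simp add: sign_def)
    show "A $$ (i, q i) \<in> \<int>" if "i \<in> {0..<n}" for i
      using assms(2) that \<open>q permutes {0..<n}\<close> permutes_in_image[of q "{0..<n}" i] by auto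
  qed
  then show ?thesis using assms(1) by (auto simp: Determinant.det_def intro!: Ints_sum)
qed

text \<open>
  Solving for the unit vectors gives an integral right inverse; both determinants are then integers
  with product \<open>1\<close>.
\<close>

lemma unimodular_if_surjective_on_integer_vectors:
  fixes A :: "real mat"
  assumes A: "A \<in> carrier_mat n n" and int: "\<And>i j. i < n \<Longrightarrow> j < n \<Longrightarrow> A $$ (i, j) \<in> \<int>"
    and surj: "\<And>b :: nat \<Rightarrow> int. \<exists>x :: nat \<Rightarrow> int. \<forall>r<n. (\<Sum>s<n. A $$ (r, s) * of_int (x s)) = of_int (b r)"
  shows "invertible_mat A" "\<bar>Determinant.det A\<bar> = 1"
proof -
  have "\<forall>j. \<exists>x :: nat \<Rightarrow> int. \<forall>r<n. (\<Sum>s<n. A $$ (r, s) * of_int (x s)) = of_int (of_bool (r = j))"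
  proof
    fix j :: nat
    show "\<exists>x :: nat \<Rightarrow> int. \<forall>r<n. (\<Sum>s<n. A $$ (r, s) * of_int (x s)) = of_int (of_bool (r = j))"
      by (rule surj)
  qed
  from choice[OF this] obtain X :: "nat \<Rightarrow> nat \<Rightarrow> int"
    where X: "\<And>j r. r < n \<Longrightarrow> (\<Sum>s<n. A $$ (r, s) * of_int (X j s)) = of_int (of_bool (r = j))"
    by blast
  define B where "B = Matrix.mat n n (\<lambda>(s, j). of_int (X j s) :: real)"
  have B: "B \<in> carrier_mat n n" by (simp add: B_def)
  have AB: "A * B = 1\<^sub>m n"
  proof (rule eq_matI)
    fix i j assume "i < dim_row (1\<^sub>m n)" "j < dim_col (1\<^sub>m n)"
    then have ij: "i < n" "j < n" by auto
    then have "(A * B) $$ (i, j) = (\<Sum>s<n. A $$ (i, s) * of_int (X j s))"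
      using A by (simp add: scalar_prod_def B_def atLeast0LessThan)
    then show "(A * B) $$ (i, j) = 1\<^sub>m n $$ (i, j)" using ij X by simp
  qed (use A B in auto)
  then have "B * A = 1\<^sub>m n" using mat_mult_left_right_inverse[OF A B] by simp
  then show "invertible_mat A"
    using A B AB by (auto simp: invertible_mat_def inverts_mat_def square_mat.simps)
  obtain a b where ab: "Determinant.det A = of_int a" "Determinant.det B = of_int b"
    using det_Ints[OF A int] det_Ints[OF B] by (auto simp: B_def elim!: Ints_cases)
  have "Determinant.det A * Determinant.det B = 1"
    using det_mult[OF A B] AB by simp
  then have "a * b = 1" unfolding ab by (metis of_int_1 of_int_eq_iff of_int_mult)
  then have "\<bar>a\<bar> = 1" by (metis zmult_eq_1_iff abs_1 abs_minus_cancel)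
  then show "\<bar>Determinant.det A\<bar> = 1" unfolding ab by linarith
qed

lemma face_in_face_list: "T \<in> set (tets X) \<Longrightarrow> k < 4 \<Longrightarrow> face X T k \<in> set (face_list X)"
  by (auto simp: face_list_def intro!: bexI[of _ T])

text \<open>
  Reduces the determinant to solving the face equations with integral right-hand sides, a problem
  that does not mention the enumeration of rows and columns.
\<close>

lemma delta_matrix_unimodular:
  assumes dist: "distinct (tets X)" and sq: "length (face_list X) = 2 * length (tets X)"
    and solv: "\<And>\<alpha> \<beta> :: 't \<Rightarrow> int. \<exists>x :: 'f \<Rightarrow> int. \<forall>T\<in>set (tets X).
       x (face X T 0) - x (face X T 1) + x (face X T 2) = \<alpha> T \<and>
       x (face X T 2) - x (face X T 3) = \<beta> T"
  shows "invertible_mat (delta_matrix X)" "\<bar>Determinant.det (delta_matrix X)\<bar> = 1"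
proof -
  let ?n = "2 * length (tets X)"
  let ?A = "delta_matrix X"
  have A: "?A \<in> carrier_mat ?n ?n" by (simp add: delta_matrix_def sq)
  have int: "?A $$ (i, j) \<in> \<int>" if "i < ?n" "j < ?n" for i j
    using that by (auto simp: delta_matrix_def sq Let_def intro!: Ints_add Ints_diff)
  have bij: "bij_betw (nth (face_list X)) {..<?n} (set (face_list X))"
    unfolding sq[symmetric] by (intro bij_betw_nth) (auto simp: face_list_def)
  have delta: "(\<Sum>y\<in>set (face_list X). of_bool (z = y) * h y) = h z"
    if "z \<in> set (face_list X)" for z and h :: "'f \<Rightarrow> real"
  proof -
    have "(\<Sum>y\<in>set (face_list X). of_bool (z = y) * h y) = (\<Sum>y\<in>set (face_list X). if z = y then h y else 0)"
      by (intro sum.cong) auto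
    then show ?thesis using that by (simp add: sum.delta)
  qed
  have surj: "\<exists>x :: nat \<Rightarrow> int. \<forall>r<?n. (\<Sum>s<?n. ?A $$ (r, s) * of_int (x s)) = of_int (b r)"
    for b :: "nat \<Rightarrow> int"
  proof -
    define idx where "idx = the_inv_into {..<length (tets X)} (nth (tets X))"
    have idx: "idx (tets X ! i) = i" if "i < length (tets X)" for i
      unfolding idx_def using that inj_on_nth[OF dist, of "{..<length (tets X)}"]
      by (intro the_inv_into_f_f) auto
    obtain x :: "'f \<Rightarrow> int" where x: "\<And>T. T \<in> set (tets X) \<Longrightarrow>
       x (face X T 0) - x (face X T 1) + x (face X T 2) = b (2 * idx T) \<and>
       x (face X T 2) - x (face X T 3) = b (Suc (2 * idx T))"
      using solv[of "\<lambda>T. b (2 * idx T)" "\<lambda>T. b (Suc (2 * idx T))"] by blast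
    show ?thesis
    proof (intro exI[of _ "\<lambda>s. x (face_list X ! s)"] allI impI)
      fix r assume r: "r < ?n"
      define T where "T = tets X ! (r div 2)"
      have T: "T \<in> set (tets X)" "idx T = r div 2" using r idx by (auto simp: T_def)
      note mem = face_in_face_list[OF T(1)]
      define c :: "'f \<Rightarrow> real" where "c = (\<lambda>y. if even r
          then of_bool (face X T 0 = y) - of_bool (face X T 1 = y) + of_bool (face X T 2 = y)
          else of_bool (face X T 2 = y) - of_bool (face X T 3 = y))"
      have "(\<Sum>s<?n. ?A $$ (r, s) * of_int (x (face_list X ! s)))
          = (\<Sum>s<?n. c (face_list X ! s) * of_int (x (face_list X ! s)))"
        using r by (intro sum.cong) (auto simp: delta_matrix_def sq c_def T_def Let_def)
      also have "\<dots> = (\<Sum>y\<in>set (face_list X). c y * of_int (x y))"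
        by (rule sum.reindex_bij_betw[OF bij])
      also have "\<dots> = of_int (b r)"
      proof (cases "even r")
        case True
        then have "(\<Sum>y\<in>set (face_list X). c y * of_int (x y))
            = real_of_int (x (face X T 0) - x (face X T 1) + x (face X T 2))"
          using mem by (simp add: c_def distrib_right left_diff_distrib sum.distrib sum_subtractf delta)
        then show ?thesis using x[OF T(1)] T(2) True by simp
      next
        case False
        then have "(\<Sum>y\<in>set (face_list X). c y * of_int (x y))
            = real_of_int (x (face X T 2) - x (face X T 3))"
          using mem by (simp add: c_def left_diff_distrib sum_subtractf delta)
        then show ?thesis using x[OF T(1)] T(2) False by simp
      qed
      finally show "(\<Sum>s<?n. ?A $$ (r, s) * of_int (x (face_list X ! s))) = of_int (b r)" .
    qed
  qed
  show "invertible_mat ?A" "\<bar>Determinant.det ?A\<bar> = 1"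
    using unimodular_if_surjective_on_integer_vectors[OF A int surj] by blast+
qed

section \<open>The face equations of the twist knot triangulation\<close>

lemma set_tets_twist: "set (tets (twist_triangulation p)) = insert TV (J_index p)"
  by (auto simp: twist_triangulation_def J_index_def)

lemma ball_tets_twist:
  "(\<forall>T\<in>set (tets (twist_triangulation p)). P T) \<longleftrightarrow> (\<forall>k\<in>{1..p}. P (TT k)) \<and> P TU \<and> P TV \<and> P TW"
  by (auto simp: set_tets_twist J_index_def)

lemma face_twist [simp]: "face (twist_triangulation p) T k = twist_faces p T ! k"
  by (simp add: twist_triangulation_def)

lemma set_face_list_twist:
  "set (face_list (twist_triangulation p)) = Fe ` {1..p + 1} \<union> Ff ` {1..p} \<union> {Fv, Fr, Fs, Fg, Fu}"
proof -
  have [simp]: "[0..<4] = [0, 1, 2, 3]" by (simp add: upt_rec)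
  have "set (face_list (twist_triangulation p))
      = (\<Union>T\<in>set (tets (twist_triangulation p)). set (twist_faces p T))"
  proof -
    have "map (nth (twist_faces p T)) [0..<4] = twist_faces p T" for T
      by (cases T) auto
    then show ?thesis by (simp add: face_list_def)
  qed
  also have "\<dots> = Fe ` {1..p + 1} \<union> Ff ` {1..p} \<union> {Fv, Fr, Fs, Fg, Fu}" (is "?L = ?R")
  proof
    have "\<forall>T\<in>set (tets (twist_triangulation p)). set (twist_faces p T) \<subseteq> ?R"
    proof -
      define R where "R = ?R"
      have "Fe k \<in> R" if "1 \<le> k" "k \<le> p + 1" for k using that by (auto simp: R_def)
      moreover have "twist_f k \<in> R" if "k \<le> p" for k using that by (auto simp: R_def twist_f_def)
      moreover have "{Fv, Fr, Fs, Fg, Fu} \<subseteq> R" by (auto simp: R_def)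
      ultimately show ?thesis unfolding R_def[symmetric] ball_tets_twist by auto
    qed
    then show "?L \<subseteq> ?R" by blast
    have "Fe k \<in> ?L" if "k \<in> {1..p + 1}" for k
    proof (cases "k = p + 1")
      case True
      then show ?thesis by (auto simp: set_tets_twist J_index_def)
    next
      case False
      then have "TT k \<in> set (tets (twist_triangulation p))" using that by (auto simp: set_tets_twist J_index_def)
      then show ?thesis by (rule UN_I) simp
    qed
    moreover have "Ff k \<in> ?L" if "k \<in> {1..p}" for k
    proof -
      have "TT k \<in> set (tets (twist_triangulation p))" using that by (auto simp: set_tets_twist J_index_def)
      then show ?thesis by (rule UN_I) (use that in \<open>simp add: twist_f_def\<close>)
    qed
    moreover have "{Fv, Fr, Fs, Fg, Fu} \<subseteq> ?L" by (auto simp: set_tets_twist J_index_def)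
    ultimately show "?R \<subseteq> ?L" by blast
  qed
  finally show ?thesis .
qed

text \<open>
  The equations \<open>x\<^sub>2(T) - x\<^sub>3(T) = \<beta>\<^sub>T\<close> of the tower \<open>T\<^sub>1, \<dots>, T\<^sub>p\<close> determine \<open>f\<^sub>0, \<dots>, f\<^sub>p\<close> up to a constant, which the
  equations of \<open>U\<close> and \<open>V\<close> fix through \<open>f\<^sub>p = \<alpha>\<^sub>V + \<beta>\<^sub>U\<close>; then \<open>e\<^sub>k\<^sub>+\<^sub>1 = e\<^sub>k + f\<^sub>k - \<alpha>\<^sub>k\<close> with \<open>e\<^sub>1 = f\<^sub>0\<close>,
  and the remaining five faces follow one after the other.  No division occurs.
\<close>

lemma delta_matrix_twist:
  "invertible_mat (delta_matrix (twist_triangulation p))"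
  "\<bar>Determinant.det (delta_matrix (twist_triangulation p))\<bar> = 1"
proof -
  let ?X = "twist_triangulation p"
  have dist: "distinct (tets ?X)"
    by (auto simp: twist_triangulation_def distinct_map inj_on_def)
  have "length (face_list ?X) = card (set (face_list ?X))"
    by (simp add: face_list_def length_remdups_card_conv)
  also have "\<dots> = card (Fe ` {1..p + 1} \<union> Ff ` {1..p}) + 5"
    unfolding set_face_list_twist by (subst card_Un_disjoint) auto
  also have "\<dots> = 2 * length (tets ?X)"
    by (subst card_Un_disjoint) (auto simp: card_image inj_on_def twist_triangulation_def)
  finally have sq: "length (face_list ?X) = 2 * length (tets ?X)" .
  have solv: "\<exists>x :: twist_face \<Rightarrow> int. \<forall>T\<in>set (tets ?X).
       x (face ?X T 0) - x (face ?X T 1) + x (face ?X T 2) = \<alpha> T \<and>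
       x (face ?X T 2) - x (face ?X T 3) = \<beta> T" for \<alpha> \<beta>
  proof -
    define f where "f k = \<alpha> TV + \<beta> TU - (\<Sum>j = Suc k..p. \<beta> (TT j))" for k
    define e where "e k = f 0 + (\<Sum>i = 1..<k. f i - \<alpha> (TT i))" for k
    define u where "u = f p - \<beta> TV"
    define v where "v = e (p + 1) + \<beta> TW"
    define r where "r = u + v - \<alpha> TW"
    define s where "s = \<alpha> TU + v - r"
    define x where "x F = (case F of Fe k \<Rightarrow> e k | Ff k \<Rightarrow> f k | Fu \<Rightarrow> u | Fv \<Rightarrow> v | Fr \<Rightarrow> r | Fs \<Rightarrow> s
        | Fg \<Rightarrow> s - \<beta> TU)" for F
    have xf: "x (twist_f k) = f k" for k
      by (simp add: twist_f_def x_def e_def)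
    have estep: "e (Suc k) = e k + f k - \<alpha> (TT k)" if "k \<ge> 1" for k
      using that by (simp add: e_def)
    have fstep: "f k = f (k - 1) + \<beta> (TT k)" if "k \<ge> 1" "k \<le> p" for k
      using that by (simp add: f_def sum.atLeast_Suc_atMost)
    have x_simps: "x (Fe k) = e k" "x Fu = u" "x Fv = v" "x Fr = r" "x Fs = s" "x Fg = s - \<beta> TU" for k
      by (simp_all add: x_def)
    show ?thesis
      unfolding ball_tets_twist
      by (rule exI[of _ x])
         (auto simp: xf x_simps estep fstep numeral_2_eq_2 numeral_3_eq_3 r_def s_def u_def v_def f_def[of p])
  qed
  show "invertible_mat (delta_matrix ?X)" "\<bar>Determinant.det (delta_matrix ?X)\<bar> = 1"
    using delta_matrix_unimodular[OF dist sq solv] by blast+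
qed

text \<open>
  The same solution for the right-hand sides that occur in the kernel.  The coefficients
  \<open>min(j, k)\<close> and \<open>-k\<close> of the faces \<open>e\<^sub>k\<close> are those of the matrix \<open>Q\<^sub>n\<close>.
\<close>

definition twist_delta_solution :: "nat \<Rightarrow> (twist_tet \<Rightarrow> real) \<Rightarrow> twist_face \<Rightarrow> real" where
  "twist_delta_solution p t F =
    (let e = (\<lambda>k. (\<Sum>j = 1..p. real (min j k) * t (TT j)) - real k * t TU);
         u = t TV - t TU; v = e (p + 1) - t TW
     in case F of
          Fe k \<Rightarrow> e k
        | Ff k \<Rightarrow> (\<Sum>j = 1..p. of_bool (k < j) * t (TT j)) - t TU
        | Fu \<Rightarrow> u | Fv \<Rightarrow> v | Fr \<Rightarrow> u + v | Fs \<Rightarrow> - u | Fg \<Rightarrow> t TU - u)"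

lemma twist_delta_solution_solves:
  "\<forall>T\<in>set (tets (twist_triangulation p)).
     twist_delta_solution p t (twist_faces p T ! 0) - twist_delta_solution p t (twist_faces p T ! 1)
       + twist_delta_solution p t (twist_faces p T ! 2) = 0 \<and>
     twist_delta_solution p t (twist_faces p T ! 2) - twist_delta_solution p t (twist_faces p T ! 3) + t T = 0"
proof -
  let ?x = "twist_delta_solution p t"
  have f: "?x (twist_f k) = (\<Sum>j = 1..p. of_bool (k < j) * t (TT j)) - t TU" for k
    by (auto simp: twist_f_def twist_delta_solution_def intro!: sum.cong)
  have fp: "?x (twist_f p) = - t TU" by (simp add: f)
  have estep: "?x (Fe k) - ?x (Fe (Suc k)) + ?x (twist_f k) = 0" for k
  proof -
    have "(\<Sum>j = 1..p. real (min j k) * t (TT j)) + (\<Sum>j = 1..p. of_bool (k < j) * t (TT j))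
        = (\<Sum>j = 1..p. real (min j (Suc k)) * t (TT j))"
      unfolding sum.distrib[symmetric]
    proof (intro sum.cong refl)
      fix j :: nat
      have "min j (Suc k) = min j k + of_bool (k < j)" by auto
      then show "real (min j k) * t (TT j) + of_bool (k < j) * t (TT j) = real (min j (Suc k)) * t (TT j)"
        by (simp add: distrib_right)
    qed
    then show ?thesis unfolding f by (simp add: twist_delta_solution_def algebra_simps)
  qed
  have fstep: "?x (twist_f k) - ?x (twist_f (k - 1)) + t (TT k) = 0" if "k \<in> {1..p}" for k
  proof -
    have "(\<Sum>j = 1..p. of_bool (k - 1 < j) * t (TT j))
        = (\<Sum>j = 1..p. of_bool (k < j) * t (TT j) + (if k = j then t (TT j) else 0))"
      using that by (intro sum.cong) auto
    also have "\<dots> = (\<Sum>j = 1..p. of_bool (k < j) * t (TT j)) + t (TT k)"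
      using that by (simp add: sum.distrib)
    finally show ?thesis unfolding f by simp
  qed
  show ?thesis
    unfolding ball_tets_twist using estep fstep
    by (auto simp: fp numeral_2_eq_2 numeral_3_eq_3) (simp_all add: twist_delta_solution_def Let_def)
qed

text \<open>
  Uniqueness of the solution, needed to evaluate the definite description in \<open>delta_solution\<close>.
\<close>

lemma twist_delta_homogeneous:
  fixes d :: "twist_face \<Rightarrow> real"
  assumes "\<forall>T\<in>set (tets (twist_triangulation p)).
     d (twist_faces p T ! 0) - d (twist_faces p T ! 1) + d (twist_faces p T ! 2) = 0 \<and>
     d (twist_faces p T ! 2) - d (twist_faces p T ! 3) = 0"
    and "F \<in> set (face_list (twist_triangulation p))"
  shows "d F = 0"
proof -
  have step: "d (Fe k) - d (Fe (Suc k)) + d (twist_f k) = 0" "d (twist_f k) = d (twist_f (k - 1))"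
    if "k \<in> {1..p}" for k
    using bspec[OF assms(1), of "TT k"] that
    by (simp_all add: set_tets_twist J_index_def numeral_2_eq_2 numeral_3_eq_3)
  have UVW: "d Fr - d Fv + d Fs = 0" "d Fs - d Fg = 0" "d Fg - d Fs + d (twist_f p) = 0"
    "d (twist_f p) - d Fu = 0" "d Fu - d Fr + d Fv = 0" "d Fv - d (Fe (p + 1)) = 0"
    using assms(1) unfolding ball_tets_twist by (auto simp: numeral_2_eq_2 numeral_3_eq_3)
  have "d (twist_f k) = d (twist_f 0)" if "k \<le> p" for k
    using that
  proof (induction k)
    case (Suc k)
    then show ?case using step(2)[of "Suc k"] by simp
  qed simp
  then have f: "d (twist_f k) = 0" if "k \<le> p" for k
    using that UVW(2,3) by (metis add_0 diff_self eq_iff_diff_eq_0 minus_diff_eq neg_equal_0_iff_equal order_refl)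
  have e: "d (Fe (Suc k)) = 0" if "k \<le> p" for k
    using that
  proof (induction k)
    case 0
    then show ?case using f[of 0] by (simp add: twist_f_def)
  next
    case (Suc k)
    then show ?case using step(1)[of "Suc k"] f[of "Suc k"] by simp
  qed
  have "d (Fe k) = 0" if "k \<in> {1..p + 1}" for k using e[of "k - 1"] that by auto
  moreover have "d (Ff k) = 0" if "k \<in> {1..p}" for k using f[of k] that by (auto simp: twist_f_def)
  moreover have "d Fv = 0" "d Fu = 0" "d Fr = 0" "d Fs = 0" "d Fg = 0"
    using UVW e[of p] f[of p] by auto
  ultimately show ?thesis using assms(2) unfolding set_face_list_twist by auto
qed

lemma delta_solution_twist:
  assumes "F \<in> set (face_list (twist_triangulation p))"
  shows "delta_solution (twist_triangulation p) t F = twist_delta_solution p t F"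
proof -
  let ?X = "twist_triangulation p"
  let ?S = "set (face_list ?X)"
  have "delta_solution ?X t = restrict (twist_delta_solution p t) ?S"
    unfolding delta_solution_def
  proof (rule the_equality)
    have "restrict (twist_delta_solution p t) ?S (face ?X T k) = twist_delta_solution p t (face ?X T k)"
      if "T \<in> set (tets ?X)" "k < 4" for T k
      using face_in_face_list[OF that] by simp
    then show "restrict (twist_delta_solution p t) ?S \<in> extensional ?S \<and>
        (\<forall>T\<in>set (tets ?X).
           restrict (twist_delta_solution p t) ?S (face ?X T 0) - restrict (twist_delta_solution p t) ?S (face ?X T 1)
             + restrict (twist_delta_solution p t) ?S (face ?X T 2) = 0 \<and>
           restrict (twist_delta_solution p t) ?S (face ?X T 2) - restrict (twist_delta_solution p t) ?S (face ?X T 3) + t T = 0)"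
      using twist_delta_solution_solves[of p t] by (simp del: face_twist) simp
  next
    fix x assume x: "x \<in> extensional ?S \<and> (\<forall>T\<in>set (tets ?X).
           x (face ?X T 0) - x (face ?X T 1) + x (face ?X T 2) = 0 \<and>
           x (face ?X T 2) - x (face ?X T 3) + t T = 0)"
    have "x F - twist_delta_solution p t F = 0" if "F \<in> ?S" for F
    proof (rule twist_delta_homogeneous[OF _ that])
      show "\<forall>T\<in>set (tets ?X).
         (x (twist_faces p T ! 0) - twist_delta_solution p t (twist_faces p T ! 0))
         - (x (twist_faces p T ! 1) - twist_delta_solution p t (twist_faces p T ! 1))
         + (x (twist_faces p T ! 2) - twist_delta_solution p t (twist_faces p T ! 2)) = 0 \<and>
         (x (twist_faces p T ! 2) - twist_delta_solution p t (twist_faces p T ! 2))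
         - (x (twist_faces p T ! 3) - twist_delta_solution p t (twist_faces p T ! 3)) = 0"
      proof
        fix T assume T: "T \<in> set (tets ?X)"
        from bspec[OF conjunct2[OF x] T] bspec[OF twist_delta_solution_solves[of p t] T]
        show "(x (twist_faces p T ! 0) - twist_delta_solution p t (twist_faces p T ! 0))
         - (x (twist_faces p T ! 1) - twist_delta_solution p t (twist_faces p T ! 1))
         + (x (twist_faces p T ! 2) - twist_delta_solution p t (twist_faces p T ! 2)) = 0 \<and>
         (x (twist_faces p T ! 2) - twist_delta_solution p t (twist_faces p T ! 2))
         - (x (twist_faces p T ! 3) - twist_delta_solution p t (twist_faces p T ! 3)) = 0"
          unfolding face_twist by (elim conjE, intro conjI) linarith+
      qed
    qed
    then show "x = restrict (twist_delta_solution p t) ?S"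
      using x by (intro extensionalityI[of _ ?S]) auto
  qed
  then show ?thesis using assms by simp
qed

section \<open>The edges of the twist knot triangulation\<close>

text \<open>
  A complete invariant of the edge classes.  Along the tower \<open>T\<^sub>1, \<dots>, T\<^sub>p\<close>, the edges \<open>03\<close> of \<open>T\<^sub>k\<close>, \<open>13\<close> and
  \<open>02\<close> of \<open>T\<^sub>k\<^sub>+\<^sub>1\<close> and \<open>12\<close> of \<open>T\<^sub>k\<^sub>+\<^sub>2\<close> are glued, and this class has label \<open>k\<close>; the class of all edges
  \<open>01\<close> and \<open>23\<close> of the tower fits in as \<open>k = -1\<close>.  The last two classes of the sequence are
  \<open>p - 1\<close> and \<open>p\<close>, and \<open>-2\<close> is the class that avoids the tower.  Integer labels make the formula uniform
  in \<open>p\<close>: for \<open>p = 0\<close> the classes \<open>-1\<close> and \<open>p - 1\<close> do coincide.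
\<close>

fun twist_edge_label :: "nat \<Rightarrow> twist_tet \<Rightarrow> nat \<times> nat \<Rightarrow> int" where
  "twist_edge_label p (TT k) e =
     (if e \<in> {(0, 1), (2, 3)} then - 1 else if e = (0, 3) then int k
      else if e = (1, 2) then int k - 2 else int k - 1)"
| "twist_edge_label p TU e =
     (if e \<in> {(0, 1), (2, 3)} then - 2 else if e = (0, 2) then int p - 1 else int p)"
| "twist_edge_label p TV e =
     (if e = (0, 1) then - 1 else if e \<in> {(0, 2), (1, 2)} then - 2
      else if e = (1, 3) then int p - 1 else int p)"
| "twist_edge_label p TW e =
     (if e = (0, 1) then int p - 1 else if e \<in> {(0, 2), (0, 3)} then int p
      else if e = (1, 2) then - 1 else - 2)"

text \<open>
  The label of an edge of a face, computed from the face alone.  That it agrees with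
  \<open>twist_edge_label\<close> on both sides of the face is what makes the labels invariant under gluing.
\<close>

fun twist_face_edge_label :: "nat \<Rightarrow> twist_face \<Rightarrow> nat \<times> nat \<Rightarrow> int" where
  "twist_face_edge_label p (Fe k) e =
     (if e = (0, 1) then int k - 2 else if e = (0, 2) then int k - 1 else - 1)"
| "twist_face_edge_label p (Ff k) e =
     (if e = (0, 1) then - 1 else if e = (0, 2) then int k else int k - 1)"
| "twist_face_edge_label p Fv e =
     (if e = (0, 1) then int p - 1 else if e = (0, 2) then int p else - 2)"
| "twist_face_edge_label p Fr e = (if e = (1, 2) then - 2 else int p)"
| "twist_face_edge_label p Fs e = (if e = (0, 1) then - 2 else int p)"
| "twist_face_edge_label p Fg e =
     (if e = (0, 1) then - 2 else if e = (0, 2) then int p - 1 else int p)"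
| "twist_face_edge_label p Fu e = (if e = (0, 1) then - 1 else - 2)"

lemma less_4_cases: "(k::nat) < 4 \<Longrightarrow> k = 0 \<or> k = 1 \<or> k = 2 \<or> k = 3" by auto

lemma twist_edge_label_face:
  assumes "T \<in> set (tets (twist_triangulation p))" "k < 4" "m < m'" "m' < 3"
  shows "twist_edge_label p T (face_vertex k m, face_vertex k m')
           = twist_face_edge_label p (face (twist_triangulation p) T k) (m, m')"
proof -
  have m: "(m, m') = (0, 1) \<or> (m, m') = (0, 2) \<or> (m, m') = (1, 2)" using assms(3,4) by auto
  have "T = TU \<or> T = TV \<or> T = TW \<or> (\<exists>j. T = TT j \<and> 1 \<le> j \<and> j \<le> p)"
    using assms(1) by (auto simp: set_tets_twist J_index_def)
  then show ?thesis
    using less_4_cases[OF assms(2)] m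
    by (elim disjE exE conjE) (simp_all add: face_vertex_def twist_f_def numeral_2_eq_2 numeral_3_eq_3)
qed

lemma edge_gluing_sym:
  assumes "(x, y) \<in> edge_gluing X"
  shows "(y, x) \<in> edge_gluing X"
proof -
  from assms obtain T T' k l m m' where
    "(y, x) = ((T', face_vertex l m, face_vertex l m'), (T, face_vertex k m, face_vertex k m'))"
    "T' \<in> set (tets X) \<and> T \<in> set (tets X) \<and> l < 4 \<and> k < 4 \<and> face X T' l = face X T k \<and> m < m' \<and> m' < 3"
    unfolding edge_gluing_def by force
  then show ?thesis unfolding edge_gluing_def by blast
qed

lemma edge_gluing_equivalence_sym: "(x, y) \<in> (edge_gluing X)\<^sup>* \<Longrightarrow> (y, x) \<in> (edge_gluing X)\<^sup>*"
  using edge_gluing_sym by (metis sym_def sym_rtrancl)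

lemma edge_gluingI:
  assumes "T \<in> set (tets X)" "T' \<in> set (tets X)" "k < 4" "l < 4" "face X T k = face X T' l" "m < m'" "m' < 3"
    "i = face_vertex k m" "j = face_vertex k m'" "i' = face_vertex l m" "j' = face_vertex l m'"
  shows "((T, i, j), (T', i', j')) \<in> (edge_gluing X)\<^sup>*"
  using assms unfolding edge_gluing_def by blast

lemma twist_edge_label_glued:
  assumes "(x, y) \<in> (edge_gluing (twist_triangulation p))\<^sup>*"
  shows "twist_edge_label p (fst x) (snd x) = twist_edge_label p (fst y) (snd y)"
  using assms
proof induction
  case (step y z)
  from step(2) have "twist_edge_label p (fst y) (snd y) = twist_edge_label p (fst z) (snd z)"
    unfolding edge_gluing_def by (auto simp: twist_edge_label_face simp del: face_twist)
  then show ?case using step.IH by simp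
qed simp

lemma edge_gluing_tet_edges:
  assumes "(x, y) \<in> (edge_gluing X)\<^sup>*" "x \<in> tet_edges X"
  shows "y \<in> tet_edges X"
  using assms
  by induction (auto simp: edge_gluing_def tet_edges_def face_vertex_def)

text \<open>
  A chosen edge in each class.  The tests are ordered so that \<open>p - 1 = -1\<close>, which happens for \<open>p = 0\<close>, is
  resolved in favour of the edge \<open>01\<close> of \<open>V\<close>.
\<close>

definition twist_edge_rep :: "nat \<Rightarrow> int \<Rightarrow> twist_tet \<times> nat \<times> nat" where
  "twist_edge_rep p l =
     (if l = - 2 then (TU, 0, 1) else if l = - 1 then (TV, 0, 1) else if l = int p then (TU, 0, 3)
      else if l = int p - 1 then (TU, 0, 2) else (TT (nat l + 1), 0, 2))"

lemma tet_edges_eq: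
  fixes X :: "('t, 'f) triangulation"
  shows "tet_edges X = set (tets X) \<times> {(0, 1), (0, 2), (0, 3), (1, 2), (1, 3), (2, 3)}" (is "_ = _ \<times> ?E")
proof (rule Set.set_eqI)
  fix x :: "'t \<times> nat \<times> nat"
  obtain T i j where x: "x = (T, i, j)" by (cases x)
  have "i < j \<and> j < 4 \<longleftrightarrow> (i, j) \<in> ?E"
    using less_4_cases[of j] less_4_cases[of i] by auto
  then show "x \<in> tet_edges X \<longleftrightarrow> x \<in> set (tets X) \<times> ?E"
    unfolding x tet_edges_def mem_Times_iff fst_conv snd_conv by simp
qed

text \<open>
  Conversely, edges with the same label are glued: every edge is joined to the representative of its
  label, inside \<open>U\<close>, \<open>V\<close>, \<open>W\<close> by a short chain of gluings, and in the tower by a step to a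
  neighbouring tetrahedron or by climbing to the upper end.
\<close>

lemma twist_edge_connected:
  assumes "(T, e) \<in> tet_edges (twist_triangulation p)"
  shows "((T, e), twist_edge_rep p (twist_edge_label p T e)) \<in> (edge_gluing (twist_triangulation p))\<^sup>*"
proof -
  let ?X = "twist_triangulation p"
  define eq (infix "~~" 50) where "x ~~ y \<longleftrightarrow> (x, y) \<in> (edge_gluing ?X)\<^sup>*" for x y
  have sym: "x ~~ y \<Longrightarrow> y ~~ x" for x y unfolding eq_def by (rule edge_gluing_equivalence_sym)
  have trans [trans]: "x ~~ y \<Longrightarrow> y ~~ z \<Longrightarrow> x ~~ z" for x y z unfolding eq_def by (rule rtrancl_trans)
  have refl: "x ~~ x" for x unfolding eq_def by simp
  have glue: "(T, face_vertex k m, face_vertex k m') ~~ (T', face_vertex l m, face_vertex l m')"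
    if "T \<in> set (tets ?X)" "T' \<in> set (tets ?X)" "k < 4" "l < 4" "twist_faces p T ! k = twist_faces p T' ! l"
       "m < m'" "m' < 3" for T T' k l m m'
    unfolding eq_def using that by (intro edge_gluingI[where k = k and l = l]) auto
  have tets: "TU \<in> set (tets ?X)" "TV \<in> set (tets ?X)" "TW \<in> set (tets ?X)"
      "1 \<le> k \<Longrightarrow> k \<le> p \<Longrightarrow> TT k \<in> set (tets ?X)" for k
    by (auto simp: set_tets_twist J_index_def)
  note faces = face_vertex_def numeral_2_eq_2 numeral_3_eq_3 twist_f_def
  \<comment> \<open>the faces \<open>g\<close>, \<open>s\<close>, \<open>r\<close>, \<open>v\<close>, \<open>u\<close> between \<open>U\<close>, \<open>V\<close> and \<open>W\<close>\<close>
  have g: "(TU, 0, 1) ~~ (TV, 1, 2)" "(TU, 0, 2) ~~ (TV, 1, 3)" "(TU, 1, 2) ~~ (TV, 2, 3)"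
    using glue[OF tets(1,2), of 3 0 0 1] glue[OF tets(1,2), of 3 0 0 2] glue[OF tets(1,2), of 3 0 1 2]
    by (simp_all add: faces)
  have s: "(TU, 0, 1) ~~ (TV, 0, 2)" "(TU, 0, 3) ~~ (TV, 0, 3)" "(TU, 1, 3) ~~ (TV, 2, 3)"
    using glue[OF tets(1,2), of 2 1 0 1] glue[OF tets(1,2), of 2 1 0 2] glue[OF tets(1,2), of 2 1 1 2]
    by (simp_all add: faces)
  have r: "(TU, 1, 2) ~~ (TW, 0, 2)" "(TU, 1, 3) ~~ (TW, 0, 3)" "(TU, 2, 3) ~~ (TW, 2, 3)"
    using glue[OF tets(1,3), of 0 1 0 1] glue[OF tets(1,3), of 0 1 0 2] glue[OF tets(1,3), of 0 1 1 2]
    by (simp_all add: faces)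
  have v: "(TU, 0, 2) ~~ (TW, 0, 1)" "(TU, 0, 3) ~~ (TW, 0, 3)" "(TU, 2, 3) ~~ (TW, 1, 3)"
    using glue[OF tets(1,3), of 1 2 0 1] glue[OF tets(1,3), of 1 2 0 2] glue[OF tets(1,3), of 1 2 1 2]
    by (simp_all add: faces)
  have u: "(TV, 0, 1) ~~ (TW, 1, 2)" "(TV, 0, 2) ~~ (TW, 1, 3)" "(TV, 1, 2) ~~ (TW, 2, 3)"
    using glue[OF tets(2,3), of 3 0 0 1] glue[OF tets(2,3), of 3 0 0 2] glue[OF tets(2,3), of 3 0 1 2]
    by (simp_all add: faces)
  \<comment> \<open>the faces inside the tower: \<open>e\<^sub>k\<^sub>+\<^sub>1\<close>, \<open>f\<^sub>k\<close> and the self-gluing \<open>f\<^sub>0 = e\<^sub>1\<close> of \<open>T\<^sub>1\<close>\<close>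
  have e: "(TT k, 0, 2) ~~ (TT (Suc k), 1, 2)" "(TT k, 0, 3) ~~ (TT (Suc k), 1, 3)" "(TT k, 2, 3) ~~ (TT (Suc k), 2, 3)"
    if "1 \<le> k" "Suc k \<le> p" for k
    using glue[OF tets(4)[of k] tets(4)[of "Suc k"], of 1 0 0 1] glue[OF tets(4)[of k] tets(4)[of "Suc k"], of 1 0 0 2]
      glue[OF tets(4)[of k] tets(4)[of "Suc k"], of 1 0 1 2] that by (simp_all add: faces)
  have f: "(TT k, 0, 1) ~~ (TT (Suc k), 0, 1)" "(TT k, 0, 3) ~~ (TT (Suc k), 0, 2)" "(TT k, 1, 3) ~~ (TT (Suc k), 1, 2)"
    if "1 \<le> k" "Suc k \<le> p" for k
    using glue[OF tets(4)[of k] tets(4)[of "Suc k"], of 2 3 0 1] glue[OF tets(4)[of k] tets(4)[of "Suc k"], of 2 3 0 2]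
      glue[OF tets(4)[of k] tets(4)[of "Suc k"], of 2 3 1 2] that by (simp_all add: faces)
  have f0: "(TT 1, 1, 2) ~~ (TT 1, 0, 1)" "(TT 1, 1, 3) ~~ (TT 1, 0, 2)" "(TT 1, 2, 3) ~~ (TT 1, 1, 2)"
    if "1 \<le> p"
    using glue[OF tets(4)[of 1] tets(4)[of 1], of 0 3 0 1] glue[OF tets(4)[of 1] tets(4)[of 1], of 0 3 0 2]
      glue[OF tets(4)[of 1] tets(4)[of 1], of 0 3 1 2] that by (simp_all add: faces)
  \<comment> \<open>the faces \<open>f\<^sub>p\<close> and \<open>e\<^sub>p\<^sub>+\<^sub>1\<close> at the upper end; without a tower they coincide and glue \<open>V\<close> to \<open>W\<close>\<close>
  have fp: "(TT p, 0, 1) ~~ (TV, 0, 1)" "(TT p, 0, 3) ~~ (TV, 0, 3)" "(TT p, 1, 3) ~~ (TV, 1, 3)"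
    if "1 \<le> p"
    using glue[OF tets(4)[of p] tets(2), of 2 2 0 1] glue[OF tets(4)[of p] tets(2), of 2 2 0 2]
      glue[OF tets(4)[of p] tets(2), of 2 2 1 2] that by (simp_all add: faces)
  have ep: "(TT p, 0, 2) ~~ (TW, 0, 1)" "(TT p, 0, 3) ~~ (TW, 0, 2)" "(TT p, 2, 3) ~~ (TW, 1, 2)"
    if "1 \<le> p"
    using glue[OF tets(4)[of p] tets(3), of 1 3 0 1] glue[OF tets(4)[of p] tets(3), of 1 3 0 2]
      glue[OF tets(4)[of p] tets(3), of 1 3 1 2] that by (simp_all add: faces)
  have ep0: "(TV, 0, 1) ~~ (TW, 0, 1)" "(TV, 0, 3) ~~ (TW, 0, 2)" "(TV, 1, 3) ~~ (TW, 1, 2)" if "p = 0"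
    using glue[OF tets(2,3), of 2 3 0 1] glue[OF tets(2,3), of 2 3 0 2] glue[OF tets(2,3), of 2 3 1 2] that by (simp_all add: faces)
  \<comment> \<open>the edges \<open>01\<close> and \<open>23\<close> of the whole tower form one class, reached by climbing to its upper end\<close>
  have c01: "(TT k, 0, 1) ~~ (TV, 0, 1)" if "1 \<le> k" "k \<le> p" for k
    using that(2,1)
  proof (induction k rule: inc_induct)
    case base
    then show ?case using fp(1) by simp
  next
    case (step k)
    then show ?case using f(1)[of k] trans by auto
  qed
  have c23: "(TT k, 2, 3) ~~ (TV, 0, 1)" if "1 \<le> k" "k \<le> p" for k
    using that(2,1)
  proof (induction k rule: inc_induct)
    case base
    then show ?case using trans[OF ep(3) sym[OF u(1)]] by simp
  next
    case (step k)
    then show ?case using e(3)[of k] trans by auto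
  qed
  \<comment> \<open>classes \<open>-2\<close>, \<open>p\<close> and \<open>p - 1\<close>\<close>
  have A: "(TV, 1, 2) ~~ (TU, 0, 1)" "(TV, 0, 2) ~~ (TU, 0, 1)" "(TW, 2, 3) ~~ (TU, 0, 1)"
      "(TW, 1, 3) ~~ (TU, 0, 1)" "(TU, 2, 3) ~~ (TU, 0, 1)"
  proof -
    show 1: "(TV, 1, 2) ~~ (TU, 0, 1)" by (rule sym[OF g(1)])
    show 2: "(TV, 0, 2) ~~ (TU, 0, 1)" by (rule sym[OF s(1)])
    show 3: "(TW, 2, 3) ~~ (TU, 0, 1)" by (rule trans[OF sym[OF u(3)] 1])
    show "(TW, 1, 3) ~~ (TU, 0, 1)" by (rule trans[OF sym[OF u(2)] 2])
    show "(TU, 2, 3) ~~ (TU, 0, 1)" by (rule trans[OF r(3) 3])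
  qed
  have C: "(TV, 0, 3) ~~ (TU, 0, 3)" "(TW, 0, 3) ~~ (TU, 0, 3)" "(TU, 1, 3) ~~ (TU, 0, 3)"
      "(TV, 2, 3) ~~ (TU, 0, 3)" "(TW, 0, 2) ~~ (TU, 0, 3)" "(TU, 1, 2) ~~ (TU, 0, 3)"
  proof -
    show 1: "(TV, 0, 3) ~~ (TU, 0, 3)" by (rule sym[OF s(2)])
    show 2: "(TW, 0, 3) ~~ (TU, 0, 3)" by (rule sym[OF v(2)])
    show 3: "(TU, 1, 3) ~~ (TU, 0, 3)" by (rule trans[OF r(2) 2])
    show 4: "(TV, 2, 3) ~~ (TU, 0, 3)" by (rule trans[OF sym[OF s(3)] 3])
    show 5: "(TU, 1, 2) ~~ (TU, 0, 3)" by (rule trans[OF g(3) 4])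
    show "(TW, 0, 2) ~~ (TU, 0, 3)" by (rule trans[OF sym[OF r(1)] 5])
  qed
  have D: "(TU, 0, 2) ~~ (TV, 0, 1)" if "p = 0"
    using trans[OF v(1) sym[OF ep0(1)]] that by simp
  have B: "(TW, 0, 1) ~~ (TU, 0, 2)" "(TV, 1, 3) ~~ (TU, 0, 2)"
    using sym[OF v(1)] sym[OF g(2)] .
  have Bp: "(TT p, 0, 2) ~~ (TU, 0, 2)" "(TT p, 0, 3) ~~ (TU, 0, 3)" if "1 \<le> p"
    using trans[OF ep(1) B(1)] trans[OF fp(2) C(1)] that by auto
  have h13: "(TT k, 1, 3) ~~ (TT k, 0, 2)" if "1 \<le> k" "k \<le> p" for k
  proof (cases "k = 1")
    case True
    then show ?thesis using f0(2) that by simp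
  next
    case False
    then show ?thesis using trans[OF sym[OF e(2)[of "k - 1"]] f(2)[of "k - 1"]] that by simp
  qed
  have h12: "(TT k, 1, 2) ~~ (TT (k - 1), 0, 2)" if "2 \<le> k" "k \<le> p" for k
    using sym[OF e(1)[of "k - 1"]] that by simp
  have h12': "(TT 1, 1, 2) ~~ (TV, 0, 1)" if "1 \<le> p"
    using trans[OF f0(1) c01[of 1]] that by simp
  have e6: "e \<in> {(0, 1), (0, 2), (0, 3), (1, 2), (1, 3), (2, 3)}"
    using assms by (auto simp: tet_edges_eq)
  have goal: "(T, e) ~~ twist_edge_rep p (twist_edge_label p T e)"
  proof -
    have tower: "(TT k, e) ~~ twist_edge_rep p (twist_edge_label p (TT k) e)" if k: "1 \<le> k" "k \<le> p" for k
    proof -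
      have rep02: "(TT k, 0, 2) ~~ twist_edge_rep p (int k - 1)"
        using Bp(1) refl k by (cases "k = p") (auto simp: twist_edge_rep_def nat_diff_distrib)
      have "e = (0, 1) \<or> e = (2, 3) \<or> e = (0, 2) \<or> e = (1, 3) \<or> e = (0, 3) \<or> e = (1, 2)"
        using e6 by auto
      then show ?thesis
      proof (elim disjE)
        assume "e = (0, 1)" then show ?thesis using c01[OF k] by (simp add: twist_edge_rep_def)
      next
        assume "e = (2, 3)" then show ?thesis using c23[OF k] by (simp add: twist_edge_rep_def)
      next
        assume "e = (0, 2)" then show ?thesis using rep02 by simp
      next
        assume "e = (1, 3)" then show ?thesis using trans[OF h13[OF k] rep02] by simp
      next
        assume e': "e = (0, 3)"
        show ?thesis
        proof (cases "k = p")
          case True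
          then show ?thesis using e' Bp(2) k by (simp add: twist_edge_rep_def)
        next
          case False
          have up: "(TT k, 0, 3) ~~ (TT (Suc k), 0, 2)" using f(2) k False by simp
          show ?thesis
          proof (cases "Suc k = p")
            case True
            then show ?thesis using e' k trans[OF up] Bp(1) by (auto simp: twist_edge_rep_def)
          next
            case False
            then show ?thesis using e' k \<open>k \<noteq> p\<close> up by (auto simp: twist_edge_rep_def)
          qed
        qed
      next
        assume e': "e = (1, 2)"
        show ?thesis
        proof (cases "k = 1")
          case True
          then show ?thesis using e' h12' k by (simp add: twist_edge_rep_def)
        next
          case False
          then have "nat (int k - 2) + 1 = k - 1" using k by simp
          then have "twist_edge_rep p (int k - 2) = (TT (k - 1), 0, 2)"
            using False k by (auto simp: twist_edge_rep_def)
          then show ?thesis using e' False h12[of k] k by simp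
        qed
      qed
    qed
    consider (U) "T = TU" | (V) "T = TV" | (W) "T = TW" | (T) k where "T = TT k" "1 \<le> k" "k \<le> p"
      using assms by (auto simp: tet_edges_eq set_tets_twist J_index_def)
    then show ?thesis
    proof cases
      case U
      show ?thesis
        using e6 refl A(5) C(3,6) D unfolding U by (auto simp: twist_edge_rep_def)
    next
      case V
      show ?thesis
        using e6 refl A(1,2) C(1,4) B(2) trans[OF B(2) D] unfolding V by (auto simp: twist_edge_rep_def)
    next
      case W
      show ?thesis
        using e6 refl A(3,4) C(2,5) B(1) sym[OF u(1)] trans[OF B(1) D] unfolding W
        by (auto simp: twist_edge_rep_def)
    next
      case T
      then show ?thesis using tower by simp
    qed
  qed
  then show ?thesis by (simp add: eq_def)
qed

section \<open>Consequences of the angle equations\<close>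

lemma twist_edge_class:
  assumes "x \<in> tet_edges (twist_triangulation p)"
  shows "(edge_gluing (twist_triangulation p))\<^sup>* `` {x} =
     {y \<in> tet_edges (twist_triangulation p). twist_edge_label p (fst y) (snd y) = twist_edge_label p (fst x) (snd x)}"
proof -
  let ?X = "twist_triangulation p"
  have connected: "(x, y) \<in> (edge_gluing ?X)\<^sup>*"
    if "y \<in> tet_edges ?X" "twist_edge_label p (fst y) (snd y) = twist_edge_label p (fst x) (snd x)" for y
  proof -
    have "(x, twist_edge_rep p (twist_edge_label p (fst x) (snd x))) \<in> (edge_gluing ?X)\<^sup>*"
      using twist_edge_connected[of "fst x" "snd x" p] assms by simp
    moreover have "(twist_edge_rep p (twist_edge_label p (fst x) (snd x)), y) \<in> (edge_gluing ?X)\<^sup>*"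
      using edge_gluing_equivalence_sym[OF twist_edge_connected[of "fst y" "snd y" p]] that by simp
    ultimately show ?thesis by (rule rtrancl_trans)
  qed
  show ?thesis
  proof (intro equalityI subsetI)
    fix y assume "y \<in> (edge_gluing ?X)\<^sup>* `` {x}"
    then have "(x, y) \<in> (edge_gluing ?X)\<^sup>*" by (simp only: Image_singleton_iff)
    from edge_gluing_tet_edges[OF this assms] twist_edge_label_glued[OF this]
    show "y \<in> {y \<in> tet_edges ?X. twist_edge_label p (fst y) (snd y) = twist_edge_label p (fst x) (snd x)}"
      by (simp only: mem_Collect_eq)
  next
    fix y assume "y \<in> {y \<in> tet_edges ?X. twist_edge_label p (fst y) (snd y) = twist_edge_label p (fst x) (snd x)}"
    then show "y \<in> (edge_gluing ?X)\<^sup>* `` {x}"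
      unfolding Image_singleton_iff mem_Collect_eq by (elim conjE) (rule connected)
  qed
qed

lemma sum_pick_int:
  "(\<Sum>k = 1..p. if int k - d = l then h k else 0)
     = (if 1 \<le> l + d \<and> l + d \<le> int p then h (nat (l + d)) else (0::real))"
proof -
  have "(\<Sum>k = 1..p. if int k - d = l then h k else 0)
      = (\<Sum>k = 1..p. if k = nat (l + d) then (if 1 \<le> l + d then h k else 0) else 0)"
    by (intro sum.cong) auto
  then show ?thesis by (auto simp: sum.delta)
qed

text \<open>
  The edge equation of the class with label \<open>l\<close>, for symbolic \<open>l\<close>: every tetrahedron contributes, in the
  order \<open>01, 02, 03, 12, 13, 23\<close> of its edges, those angles whose edge has label \<open>l\<close>.  In the tower, an
  edge whose label is \<open>k - d\<close> contributes the angle of the single tetrahedron \<open>T\<^sub>l\<^sub>+\<^sub>d\<close>, if it exists.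
\<close>

lemma twist_edge_equation:
  assumes abc: "(a, b, c) \<in> angle_structures (twist_triangulation p)"
    and x: "x \<in> tet_edges (twist_triangulation p)" and l: "twist_edge_label p (fst x) (snd x) = l"
  shows "((\<Sum>k = 1..p. if - 1 = l then a (TT k) else 0)
     + ((if 1 \<le> l + 1 \<and> l + 1 \<le> int p then b (TT (nat (l + 1))) else 0)
     + ((if 1 \<le> l + 0 \<and> l + 0 \<le> int p then c (TT (nat (l + 0))) else 0)
     + ((if 1 \<le> l + 2 \<and> l + 2 \<le> int p then c (TT (nat (l + 2))) else 0)
     + ((if 1 \<le> l + 1 \<and> l + 1 \<le> int p then b (TT (nat (l + 1))) else 0)
     + (\<Sum>k = 1..p. if - 1 = l then a (TT k) else 0))))))
     + (((if - 2 = l then a TU else 0) + ((if int p - 1 = l then b TU else 0) + ((if int p = l then c TU else 0) + ((if int p = l then c TU else 0) + ((if int p = l then b TU else 0) + ((if - 2 = l then a TU else 0)))))))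
      + (((if - 1 = l then a TV else 0) + ((if - 2 = l then b TV else 0) + ((if int p = l then c TV else 0) + ((if - 2 = l then c TV else 0) + ((if int p - 1 = l then b TV else 0) + ((if int p = l then a TV else 0)))))))
      + ((if int p - 1 = l then a TW else 0) + ((if int p = l then b TW else 0) + ((if int p = l then c TW else 0) + ((if - 1 = l then c TW else 0) + ((if - 2 = l then b TW else 0) + ((if - 2 = l then a TW else 0))))))))) = 2 * pi"
proof -
  let ?X = "twist_triangulation p" and ?E = "{(0, 1), (0, 2), (0, 3), (1, 2), (1, 3), (2, 3)} :: (nat \<times> nat) set"
  define pick where "pick L z = (if L = l then z else (0::real))" for L z
  define h where "h T = (\<Sum>e\<in>?E. pick (twist_edge_label p T e) (dihedral_angle (a, b, c) (T, e)))" for T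
  let ?S = "{y \<in> tet_edges ?X. twist_edge_label p (fst y) (snd y) = l}"
  have "?S \<in> edges ?X"
    unfolding edges_def using quotientI[OF x, of "(edge_gluing ?X)\<^sup>*"] twist_edge_class[OF x] l by simp
  then have "2 * pi = (\<Sum>\<epsilon>\<in>?S. dihedral_angle (a, b, c) \<epsilon>)"
    using abc by (auto simp: angle_structures_def)
  also have "\<dots> = (\<Sum>y\<in>set (tets ?X) \<times> ?E. if twist_edge_label p (fst y) (snd y) = l then dihedral_angle (a, b, c) y else 0)"
    unfolding tet_edges_eq by (intro sum.inter_filter) auto
  also have "\<dots> = (\<Sum>T\<in>set (tets ?X). h T)"
    unfolding h_def pick_def by (simp only: sum.cartesian_product' fst_conv snd_conv)
  also have "set (tets ?X) = TT ` {1..p} \<union> {TU, TV, TW}" by (auto simp: set_tets_twist J_index_def)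
  also have "(\<Sum>T\<in>TT ` {1..p} \<union> {TU, TV, TW}. h T) = (\<Sum>k = 1..p. h (TT k)) + (h TU + (h TV + h TW))"
    by (subst sum.union_disjoint) (auto simp: sum.reindex inj_on_def)
  finally have total: "(\<Sum>k = 1..p. h (TT k)) + (h TU + (h TV + h TW)) = 2 * pi" by (rule sym)
  have hT: "h (TT k) = pick (- 1) (a (TT k)) + (pick (int k - 1) (b (TT k)) + (pick (int k) (c (TT k)) + (pick (int k - 2) (c (TT k)) + (pick (int k - 1) (b (TT k)) + (pick (- 1) (a (TT k)))))))" for k
    by (simp add: h_def)
  have hU: "h TU = pick (- 2) (a TU) + (pick (int p - 1) (b TU) + (pick (int p) (c TU) + (pick (int p) (c TU) + (pick (int p) (b TU) + (pick (- 2) (a TU))))))"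
    by (simp add: h_def)
  have hV: "h TV = pick (- 1) (a TV) + (pick (- 2) (b TV) + (pick (int p) (c TV) + (pick (- 2) (c TV) + (pick (int p - 1) (b TV) + (pick (int p) (a TV))))))"
    by (simp add: h_def)
  have hW: "h TW = pick (int p - 1) (a TW) + (pick (int p) (b TW) + (pick (int p) (c TW) + (pick (- 1) (c TW) + (pick (- 2) (b TW) + (pick (- 2) (a TW))))))"
    by (simp add: h_def)
  have pick0: "(\<Sum>k = 1..p. if int k = l then c (TT k) else 0)
      = (if 1 \<le> l + 0 \<and> l + 0 \<le> int p then c (TT (nat (l + 0))) else 0)"
    using sum_pick_int[where d = 0] by (simp only: diff_0_right)
  have tower: "(\<Sum>k = 1..p. h (TT k)) = (\<Sum>k = 1..p. if - 1 = l then a (TT k) else 0)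
     + ((if 1 \<le> l + 1 \<and> l + 1 \<le> int p then b (TT (nat (l + 1))) else 0)
     + ((if 1 \<le> l + 0 \<and> l + 0 \<le> int p then c (TT (nat (l + 0))) else 0)
     + ((if 1 \<le> l + 2 \<and> l + 2 \<le> int p then c (TT (nat (l + 2))) else 0)
     + ((if 1 \<le> l + 1 \<and> l + 1 \<le> int p then b (TT (nat (l + 1))) else 0)
     + (\<Sum>k = 1..p. if - 1 = l then a (TT k) else 0)))))"
    unfolding hT pick_def sum.distrib sum_pick_int pick0 by (rule refl)
  show ?thesis
    using total unfolding tower hU hV hW pick_def .
qed

text \<open>
  With \<open>c\<^sub>0 = 0\<close>, the classes \<open>k = 0, \<dots>, p - 2\<close> give the recursion
  \<open>c\<^sub>k + 2 b\<^sub>k\<^sub>+\<^sub>1 + c\<^sub>k\<^sub>+\<^sub>2 = 2 \<pi>\<close>, that is \<open>c\<^sub>k - 2 c\<^sub>k\<^sub>+\<^sub>1 + c\<^sub>k\<^sub>+\<^sub>2 = 2 a\<^sub>k\<^sub>+\<^sub>1\<close>.  The function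
  \<open>-2 \<Sum>\<^sub>j min(j, k) a\<^sub>j\<close> has the same second difference in \<open>k\<close>, so that \<open>c\<^sub>k\<close> is this function plus a
  linear one; the class \<open>-1\<close> determines its slope.  The other two equations come from the classes
  \<open>-2\<close> and \<open>p\<close>, the latter combined with the formula for \<open>c\<^sub>p\<close>.
\<close>

lemma twist_angle_equations:
  assumes abc: "(a, b, c) \<in> angle_structures (twist_triangulation p)"
  shows "c TW = 2 * a TU - a TV"
    and "k \<in> {1..p} \<Longrightarrow> c (TT k) = 2 * pi * real k - 2 * real k * a TU - 2 * (\<Sum>j = 1..p. real (min j k) * a (TT j))"
    and "c TU + c TV = 2 * (\<Sum>j = 1..p. real j * a (TT j)) - 2 * pi * real p + 2 * real p * a TU + a TU + a TW - a TV"
proof -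
  let ?X = "twist_triangulation p"
  have sum_pi: "a T + b T + c T = pi" if "T \<in> insert TV (J_index p)" for T
    using abc that unfolding angle_structures_def set_tets_twist by auto
  note UVW = sum_pi[of TU] sum_pi[of TV] sum_pi[of TW]
  have sum_pi_T: "a (TT k) + b (TT k) + c (TT k) = pi" if "k \<in> {1..p}" for k
    using sum_pi[of "TT k"] that by (auto simp: J_index_def)
  have edge: "(T, e) \<in> tet_edges ?X" if "T \<in> insert TV (J_index p)" "e \<in> {(0, 1), (0, 2), (0, 3), (1, 2), (1, 3), (2, 3)}" for T e
    using that unfolding tet_edges_eq set_tets_twist by blast
  have J: "TU \<in> J_index p" "TW \<in> J_index p" by (auto simp: J_index_def)
  have A: "2 * a TU + b TV + c TV + a TW + b TW = 2 * pi"
    using twist_edge_equation[OF abc edge[of TU "(0, 1)"], of "- 2"] J by simp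
  show cW: "c TW = 2 * a TU - a TV"
    using A UVW J by simp
  define C where "C k = (if k = 0 then 0 else c (TT k))" for k
  define F where "F k = (\<Sum>j = 1..p. real (min j k) * a (TT j))" for k
  have E: "C k + 2 * b (TT (Suc k)) + C (Suc (Suc k)) = 2 * pi" if "Suc (Suc k) \<le> p" for k
    using twist_edge_equation[OF abc edge[of "TT (Suc k)" "(0, 2)"], of "int k"] that
    by (auto simp: J_index_def C_def nat_add_distrib)
  have D: "2 * F 1 + c (TT 1) + a TV + c TW = 2 * pi" if "1 \<le> p"
  proof -
    have "F 1 = (\<Sum>j = 1..p. a (TT j))" unfolding F_def by (intro sum.cong) auto
    then show ?thesis
      using twist_edge_equation[OF abc edge[of TV "(0, 1)"], of "- 1"] that by (simp add: sum_distrib_left)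
  qed
  have F2: "F (Suc (Suc k)) + F k = 2 * F (Suc k) - a (TT (Suc k))" if "Suc k \<le> p" for k
  proof -
    have "F (Suc (Suc k)) + F k = (\<Sum>j = 1..p. 2 * (real (min j (Suc k)) * a (TT j)) - (if j = Suc k then a (TT j) else 0))"
      unfolding F_def sum.distrib[symmetric]
    proof (intro sum.cong refl)
      fix j
      have "real (min j (Suc (Suc k))) + real (min j k) = 2 * real (min j (Suc k)) - (if j = Suc k then 1 else 0)"
        by (auto simp: min_def)
      then have "(real (min j (Suc (Suc k))) + real (min j k)) * a (TT j)
          = (2 * real (min j (Suc k)) - (if j = Suc k then 1 else 0)) * a (TT j)" by (rule arg_cong)
      then show "real (min j (Suc (Suc k))) * a (TT j) + real (min j k) * a (TT j)
          = 2 * (real (min j (Suc k)) * a (TT j)) - (if j = Suc k then a (TT j) else 0)"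
        by (auto simp: algebra_simps)
    qed
    also have "\<dots> = 2 * F (Suc k) - a (TT (Suc k))"
      using that by (simp add: sum_subtractf F_def sum_distrib_left)
    finally show ?thesis .
  qed
  have main: "C k = 2 * pi * real k - 2 * real k * a TU - 2 * F k" if "k \<le> p" for k
    using that
  proof (induction k rule: induct_nat_012)
    case 0
    then show ?case by (simp add: C_def F_def)
  next
    case 1
    then show ?case using D cW by (simp add: C_def)
  next
    case (ge2 k)
    have "a (TT (Suc k)) + b (TT (Suc k)) + C (Suc k) = pi"
      using sum_pi_T[of "Suc k"] ge2.prems by (simp add: C_def)
    then show ?case using E[of k] F2[of k] ge2 by (simp add: algebra_simps)
  qed
  show "c (TT k) = 2 * pi * real k - 2 * real k * a TU - 2 * (\<Sum>j = 1..p. real (min j k) * a (TT j))" if "k \<in> {1..p}"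
    using main[of k] that by (simp add: C_def F_def)
  have Fp: "F p = (\<Sum>j = 1..p. real j * a (TT j))"
    unfolding F_def by (intro sum.cong) auto
  have "C p + 2 * c TU + b TU + a TV + c TV + b TW + c TW = 2 * pi"
    using twist_edge_equation[OF abc edge[of TU "(0, 3)"], of "int p"] J by (auto simp: C_def)
  then show "c TU + c TV = 2 * (\<Sum>j = 1..p. real j * a (TT j)) - 2 * pi * real p + 2 * real p * a TU + a TU + a TW - a TV"
    using main[of p] cW UVW J unfolding Fp[symmetric] by (simp add: algebra_simps)
qed

section \<open>A shear of an absolutely convergent integral\<close>

text \<open>
  The coordinate \<open>i0\<close> is replaced by its difference \<open>u\<close> with the coordinate \<open>i1\<close>, and \<open>u\<close> is integrated last.
  Boundedness of the factor \<open>g i0\<close> gives integrability of the inner integrand for every single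
  \<open>u\<close>, which Fubini's theorem alone would only give almost everywhere.
\<close>

lemma integral_shear:
  fixes F :: "('i \<Rightarrow> real) \<Rightarrow> complex" and g :: "'i \<Rightarrow> real \<Rightarrow> real"
  assumes I: "finite I" "i0 \<notin> I" "i1 \<in> I"
    and F [measurable]: "F \<in> borel_measurable (\<Pi>\<^sub>M i\<in>insert i0 I. lborel)"
    and norm_F: "\<And>t. norm (F t) = (\<Prod>i\<in>insert i0 I. g i (t i))"
    and g: "\<And>i. i \<in> insert i0 I \<Longrightarrow> integrable lborel (g i)" "\<And>i s. i \<in> insert i0 I \<Longrightarrow> g i s \<ge> 0" "\<And>s. g i0 s \<le> M"
  shows "integrable (\<Pi>\<^sub>M i\<in>insert i0 I. lborel) F"
    and "integrable (\<Pi>\<^sub>M i\<in>I. lborel) (\<lambda>v. F (v(i0 := u + v i1)))"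
    and "integrable lborel (\<lambda>u. LINT v|(\<Pi>\<^sub>M i\<in>I. lborel). F (v(i0 := u + v i1)))"
    and "(LINT t|(\<Pi>\<^sub>M i\<in>insert i0 I. lborel). F t)
           = (LINT u|lborel. LINT v|(\<Pi>\<^sub>M i\<in>I. lborel). F (v(i0 := u + v i1)))"
proof -
  interpret P: product_sigma_finite "\<lambda>_ :: 'i. lborel :: real measure"
    by (simp add: product_sigma_finite_def lborel.sigma_finite_measure_axioms)
  interpret PI: finite_product_sigma_finite "\<lambda>_ :: 'i. lborel :: real measure" I
    by standard (rule I(1))
  interpret PP: pair_sigma_finite "\<Pi>\<^sub>M i\<in>I. (lborel :: real measure)" "lborel :: real measure" ..
  have fin: "finite (insert i0 I)" using I by simp
  have M0: "M \<ge> 0" using g(2)[of i0 0] g(3)[of 0] by simp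
  have norm_F_upd: "norm (F (v(i0 := y))) = g i0 y * (\<Prod>i\<in>I. g i (v i))" for v y
  proof -
    have "(\<Prod>i\<in>I. g i ((v(i0 := y)) i)) = (\<Prod>i\<in>I. g i (v i))" using I by (intro prod.cong) auto
    then show ?thesis using I by (simp add: norm_F)
  qed
  have prodI: "integrable (\<Pi>\<^sub>M i\<in>I. lborel) (\<lambda>v. \<Prod>i\<in>I. g i (v i))"
    using I(1) g(1) by (intro P.product_integrable_prod) auto
  have prod_nonneg: "(\<Prod>i\<in>I. g i (v i)) \<ge> 0" for v using g(2) by (intro prod_nonneg) auto
  show int_F: "integrable (\<Pi>\<^sub>M i\<in>insert i0 I. lborel) F"
  proof (rule Bochner_Integration.integrable_bound)
    show "integrable (\<Pi>\<^sub>M i\<in>insert i0 I. lborel) (\<lambda>t. \<Prod>i\<in>insert i0 I. g i (t i))"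
      using fin g(1) by (intro P.product_integrable_prod) auto
  qed (auto simp: norm_F simp del: prod.insert)
  have [measurable]: "(\<lambda>(v, u). v(i0 := u + v i1)) \<in> measurable ((\<Pi>\<^sub>M i\<in>I. lborel) \<Otimes>\<^sub>M lborel) (\<Pi>\<^sub>M i\<in>insert i0 I. (lborel :: real measure))"
  proof -
    have "(\<lambda>(v, u). (v, u + v i1)) \<in> measurable ((\<Pi>\<^sub>M i\<in>I. lborel) \<Otimes>\<^sub>M lborel) ((\<Pi>\<^sub>M i\<in>I. (lborel :: real measure)) \<Otimes>\<^sub>M lborel)"
      using I(3) by measurable
    from measurable_compose[OF this measurable_add_dim] show ?thesis by (simp add: case_prod_beta')
  qed
  have meas: "(\<lambda>(v, u). F (v(i0 := u + v i1))) \<in> borel_measurable ((\<Pi>\<^sub>M i\<in>I. lborel) \<Otimes>\<^sub>M lborel)"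
    by (simp add: case_prod_beta') measurable
  show "integrable (\<Pi>\<^sub>M i\<in>I. lborel) (\<lambda>v. F (v(i0 := u + v i1)))" for u
  proof (rule Bochner_Integration.integrable_bound)
    show "integrable (\<Pi>\<^sub>M i\<in>I. lborel) (\<lambda>v. M * (\<Prod>i\<in>I. g i (v i)))"
      using prodI by simp
    show "(\<lambda>v. F (v(i0 := u + v i1))) \<in> borel_measurable (\<Pi>\<^sub>M i\<in>I. lborel)"
      using measurable_compose[OF _ meas, of "\<lambda>v. (v, u)"] by simp
    show "AE v in \<Pi>\<^sub>M i\<in>I. lborel. norm (F (v(i0 := u + v i1))) \<le> norm (M * (\<Prod>i\<in>I. g i (v i)))"
      using g(3) prod_nonneg M0 by (intro AE_I2) (auto simp: norm_F_upd abs_mult intro!: mult_right_mono)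
  qed
  have affine: "integrable lborel (\<lambda>u. g i0 (u + s))" "(LINT u|lborel. g i0 (u + s)) = (LINT u|lborel. g i0 u)" for s
    using lborel_integrable_real_affine[OF g(1)[of i0], of 1 s] lborel_integral_real_affine[of 1 "g i0" s]
    by (simp_all add: add.commute)
  have pair: "integrable ((\<Pi>\<^sub>M i\<in>I. lborel) \<Otimes>\<^sub>M lborel) (\<lambda>(v, u). F (v(i0 := u + v i1)))"
  proof (rule PP.Fubini_integrable[OF meas])
    have "(\<lambda>v. LINT u|lborel. norm (case (v, u) of (v, u) \<Rightarrow> F (v(i0 := u + v i1))))
        = (\<lambda>v. (LINT u|lborel. g i0 u) * (\<Prod>i\<in>I. g i (v i)))"
      by (simp add: norm_F_upd affine)
    then show "integrable (\<Pi>\<^sub>M i\<in>I. lborel) (\<lambda>v. LINT u|lborel. norm (case (v, u) of (v, u) \<Rightarrow> F (v(i0 := u + v i1))))"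
      using prodI by simp
    show "AE v in \<Pi>\<^sub>M i\<in>I. lborel. integrable lborel (\<lambda>u. case (v, u) of (v, u) \<Rightarrow> F (v(i0 := u + v i1)))"
    proof (rule AE_I2)
      fix v :: "'i \<Rightarrow> real" assume "v \<in> space (\<Pi>\<^sub>M i\<in>I. lborel)"
      then have m: "(\<lambda>u. F (v(i0 := u + v i1))) \<in> borel_measurable lborel"
        using measurable_compose[OF measurable_Pair1' meas] by simp
      have i: "integrable lborel (\<lambda>u. g i0 (u + v i1) * (\<Prod>i\<in>I. g i (v i)))"
        by (rule integrable_mult_left) (rule affine(1))
      have "integrable lborel (\<lambda>u. F (v(i0 := u + v i1)))"
        by (rule Bochner_Integration.integrable_bound[OF i m]) (rule AE_I2, simp only: norm_F_upd real_norm_def abs_ge_self)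
      then show "integrable lborel (\<lambda>u. case (v, u) of (v, u) \<Rightarrow> F (v(i0 := u + v i1)))"
        by (simp only: prod.case)
    qed
  qed
  show "integrable lborel (\<lambda>u. LINT v|(\<Pi>\<^sub>M i\<in>I. lborel). F (v(i0 := u + v i1)))"
    by (rule PP.integrable_snd[OF pair])
  have shift: "(LINT y|lborel. F (v(i0 := y))) = (LINT u|lborel. F (v(i0 := u + v i1)))" for v
    using lborel_integral_real_affine[of 1 "\<lambda>y. F (v(i0 := y))" "v i1"] by (simp add: add.commute)
  have "(LINT t|(\<Pi>\<^sub>M i\<in>insert i0 I. lborel). F t) = (LINT v|(\<Pi>\<^sub>M i\<in>I. lborel). LINT y|lborel. F (v(i0 := y)))"
    by (rule P.product_integral_insert[OF I(1,2) int_F])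
  also have "\<dots> = (LINT v|(\<Pi>\<^sub>M i\<in>I. lborel). LINT u|lborel. F (v(i0 := u + v i1)))"
    by (simp only: shift)
  also have "\<dots> = (LINT u|lborel. LINT v|(\<Pi>\<^sub>M i\<in>I. lborel). F (v(i0 := u + v i1)))"
    by (rule PP.Fubini_integral[OF pair, symmetric])
  finally show "(LINT t|(\<Pi>\<^sub>M i\<in>insert i0 I. lborel). F t)
           = (LINT u|lborel. LINT v|(\<Pi>\<^sub>M i\<in>I. lborel). F (v(i0 := u + v i1)))" .
qed

section \<open>Exponential decay of the tetrahedral factors\<close>

definition tet_factor :: "real \<Rightarrow> int \<Rightarrow> real \<Rightarrow> real \<Rightarrow> real \<Rightarrow> complex" where
  "tet_factor \<beta> \<epsilon> a c t =
     exp (of_real (c * t / sqrt (hbar \<beta>)))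
       / quantum_dilog \<beta> (of_real t - \<i> / of_real (2 * pi * sqrt (hbar \<beta>)) * of_int \<epsilon> * of_real (pi - a)) powi \<epsilon>"

lemma tet_factor_argument:
  assumes "\<beta> > 0"
  shows "of_real t - \<i> / of_real (2 * pi * sqrt (hbar \<beta>)) * of_int \<epsilon> * of_real (pi - a)
     = Complex t (- (\<beta> + 1 / \<beta>) / (2 * pi) * of_int \<epsilon> * (pi - a))"
proof -
  have "2 * pi * sqrt (hbar \<beta>) = 2 * pi / (\<beta> + 1 / \<beta>)"
    using sqrt_hbar[OF assms] by simp
  then have \<kappa>: "1 / (2 * pi * sqrt (hbar \<beta>)) = (\<beta> + 1 / \<beta>) / (2 * pi)" by simp
  have "\<i> / of_real (2 * pi * sqrt (hbar \<beta>)) * of_int \<epsilon> * of_real (pi - a)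
      = \<i> * of_real (1 / (2 * pi * sqrt (hbar \<beta>)) * of_int \<epsilon> * (pi - a))" by simp
  then have "of_real t - \<i> / of_real (2 * pi * sqrt (hbar \<beta>)) * of_int \<epsilon> * of_real (pi - a)
      = Complex t (- ((\<beta> + 1 / \<beta>) / (2 * pi) * of_int \<epsilon> * (pi - a)))"
    unfolding \<kappa> by (simp only:) (simp add: complex_eq_iff)
  also have "- ((\<beta> + 1 / \<beta>) / (2 * pi) * of_int \<epsilon> * (pi - a)) = - (\<beta> + 1 / \<beta>) / (2 * pi) * of_int \<epsilon> * (pi - a)"
    by (simp only: minus_divide_left[symmetric] mult_minus_left)
  finally show ?thesis .
qed

lemma tet_factor_strip:
  assumes "\<beta> > 0" "\<epsilon> = 1 \<or> \<epsilon> = - 1" "0 < a" "a < pi"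
  shows "2 * \<bar>- (\<beta> + 1 / \<beta>) / (2 * pi) * of_int \<epsilon> * (pi - a)\<bar> < \<beta> + 1 / \<beta>"
proof -
  let ?Q = "\<beta> + 1 / \<beta>"
  have Q: "?Q > 0" using assms(1) by (simp add: add_pos_pos)
  have "2 * \<bar>- ?Q / (2 * pi) * of_int \<epsilon> * (pi - a)\<bar> = ?Q * ((pi - a) / pi)"
    using assms Q by (auto simp: abs_mult)
  also have "\<dots> < ?Q * 1" using Q assms by (intro mult_strict_left_mono) auto
  finally show ?thesis by simp
qed

text \<open>
  On the left the dilogarithm is bounded and \<open>c > 0\<close> gives the decay; on the right its growth
  contributes \<open>-(\<pi> - a) t\<close> to the exponent, in units of \<open>1 / sqrt hbar\<close>, and \<open>c - (\<pi> - a) = -b < 0\<close>.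
\<close>

lemma tet_factor_exponential_decay:
  assumes "\<beta> > 0" "\<epsilon> = 1 \<or> \<epsilon> = - 1" "0 < a" "0 < b" "0 < c" "a + b + c = pi"
  shows "\<exists>K \<delta>. \<delta> > 0 \<and> (\<forall>t. norm (tet_factor \<beta> \<epsilon> a c t) \<le> K * exp (- \<delta> * \<bar>t\<bar>))"
proof -
  let ?Q = "\<beta> + 1 / \<beta>"
  have Q: "?Q > 0" using assms(1) by (simp add: add_pos_pos)
  define y where "y = - ?Q / (2 * pi) * of_int \<epsilon> * (pi - a)"
  have y: "2 * \<bar>y\<bar> < ?Q" unfolding y_def using assms by (intro tet_factor_strip) auto
  have y': "of_int \<epsilon> * (2 * pi * y) = - ?Q * (pi - a)" using assms(2) by (auto simp: y_def)
  obtain K where K: "\<And>t. \<bar>ln (norm (quantum_dilog \<beta> (Complex t y))) + 2 * pi * y * max t 0\<bar> \<le> K"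
    using ln_norm_quantum_dilog_asymptotics[OF assms(1) y] by blast
  define \<delta> where "\<delta> = ?Q * min b c"
  have "norm (tet_factor \<beta> \<epsilon> a c t) \<le> exp K * exp (- \<delta> * \<bar>t\<bar>)" for t
  proof -
    define l where "l = ln (norm (quantum_dilog \<beta> (Complex t y)))"
    have nz: "norm (quantum_dilog \<beta> (Complex t y)) > 0"
      using quantum_dilog_nonzero[OF assms(1), of "Complex t y"] y by simp
    have "norm (quantum_dilog \<beta> (Complex t y) powi \<epsilon>) = exp (of_int \<epsilon> * l)"
      using assms(2) nz by (auto simp: norm_power_int l_def power_int_minus exp_minus)
    then have "norm (tet_factor \<beta> \<epsilon> a c t) = exp (?Q * c * t) / exp (of_int \<epsilon> * l)"
      unfolding tet_factor_def tet_factor_argument[OF assms(1)] y_def[symmetric]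
      by (simp add: norm_divide norm_exp_eq_Re sqrt_hbar[OF assms(1)] mult_ac)
    also have "\<dots> = exp (?Q * c * t - of_int \<epsilon> * l)" by (simp add: exp_diff)
    also have "\<dots> \<le> exp (K - \<delta> * \<bar>t\<bar>)"
    proof -
      have y'': "of_int \<epsilon> * (2 * pi * y) * max t 0 = - (?Q * (pi - a) * max t 0)"
        by (simp only: y' mult_minus_left)
      have "of_int \<epsilon> * l + of_int \<epsilon> * (2 * pi * y) * max t 0 \<ge> - K"
        using K[of t] assms(2) by (auto simp: l_def algebra_simps abs_le_iff)
      then have 1: "?Q * c * t - of_int \<epsilon> * l \<le> K + ?Q * c * t - ?Q * (pi - a) * max t 0"
        unfolding y'' by linarith
      have 2: "?Q * c * t - ?Q * (pi - a) * max t 0 \<le> - \<delta> * \<bar>t\<bar>"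
      proof (cases "t \<le> 0")
        case True
        have "min b c * - t \<le> c * - t" using True by (intro mult_right_mono) auto
        then have "?Q * (min b c * - t) \<le> ?Q * (c * - t)" using Q by (intro mult_left_mono) auto
        then show ?thesis using True by (simp add: \<delta>_def max_def mult_ac)
      next
        case False
        have "min b c * t \<le> b * t" using False by (intro mult_right_mono) auto
        then have "?Q * (min b c * t) \<le> ?Q * (b * t)" using Q by (intro mult_left_mono) auto
        moreover have "?Q * c * t - ?Q * (pi - a) * t = - (?Q * (b * t))"
          unfolding assms(6)[symmetric] by (simp add: algebra_simps add_divide_distrib)
        ultimately show ?thesis using False by (simp add: \<delta>_def max_def mult_ac)
      qed
      show ?thesis using 1 2 by simp
    qed
    finally show ?thesis by (simp add: exp_diff exp_minus divide_inverse)
  qed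
  moreover have "\<delta> > 0" using Q assms by (simp add: \<delta>_def)
  ultimately show ?thesis by blast
qed

lemma tet_factor_measurable:
  assumes "\<beta> > 0" "\<epsilon> = 1 \<or> \<epsilon> = - 1" "0 < a" "a < pi"
  shows "tet_factor \<beta> \<epsilon> a c \<in> borel_measurable borel"
proof -
  define h where "h t = quantum_dilog \<beta> (Complex t (- (\<beta> + 1 / \<beta>) / (2 * pi) * of_int \<epsilon> * (pi - a)))" for t
  have h [measurable]: "h \<in> borel_measurable borel"
    unfolding h_def[abs_def] by (intro quantum_dilog_line_measurable tet_factor_strip assms)
  show ?thesis
    using assms(2) unfolding tet_factor_def[abs_def] tet_factor_argument[OF assms(1)] h_def[symmetric]
    by (elim disjE) (simp_all add: power_int_minus)
qed

lemma tet_factor_integrable: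
  assumes "\<beta> > 0" "\<epsilon> = 1 \<or> \<epsilon> = - 1" "0 < a" "0 < b" "0 < c" "a + b + c = pi"
  shows "integrable lborel (\<lambda>t. norm (tet_factor \<beta> \<epsilon> a c t))"
    and "\<exists>M. \<forall>t. norm (tet_factor \<beta> \<epsilon> a c t) \<le> M"
proof -
  obtain K \<delta> where K: "\<delta> > 0" "\<And>t. norm (tet_factor \<beta> \<epsilon> a c t) \<le> K * exp (- \<delta> * \<bar>t\<bar>)"
    using tet_factor_exponential_decay[OF assms] by blast
  have [measurable]: "tet_factor \<beta> \<epsilon> a c \<in> borel_measurable borel"
    using assms by (intro tet_factor_measurable) auto
  show "integrable lborel (\<lambda>t. norm (tet_factor \<beta> \<epsilon> a c t))"
    by (rule Bochner_Integration.integrable_bound[OF integrable_mult_right[OF integrable_exp_neg_abs[OF K(1)], of K]])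
       (use K(2) in \<open>auto intro: order_trans[OF _ abs_ge_self]\<close>)
  have "K \<ge> 0" using order_trans[OF norm_ge_zero K(2)[of 0]] by simp
  then have "norm (tet_factor \<beta> \<epsilon> a c t) \<le> K" for t
    using order_trans[OF K(2)[of t], of K] K(1) mult_left_mono[of "exp (- \<delta> * \<bar>t\<bar>)" 1 K] by simp
  then show "\<exists>M. \<forall>t. norm (tet_factor \<beta> \<epsilon> a c t) \<le> M" by blast
qed

section \<open>The kinematical kernel as a quadratic form\<close>

lemma sum_J_index: "(\<Sum>T\<in>J_index p. h T) = (\<Sum>k = 1..p. h (TT k)) + h TU + h TW"
proof -
  have "(\<Sum>T\<in>J_index p. h T) = (\<Sum>T\<in>TT ` {1..p}. h T) + (\<Sum>T\<in>{TU, TW}. h T)"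
    unfolding J_index_def by (rule sum.union_disjoint) auto
  then show ?thesis by (simp add: sum.reindex inj_on_def add.assoc)
qed

lemma finite_J_index [simp]: "finite (J_index p)"
  by (simp add: J_index_def)

lemma J_index_simps [simp]: "TV \<notin> J_index p" "TU \<in> J_index p" "TW \<in> J_index p" "TT k \<in> J_index p \<longleftrightarrow> k \<in> {1..p}"
  by (auto simp: J_index_def)

text \<open>
  The exponent of both kernels; defined over any commutative ring since it is evaluated at real and at
  complex points.
\<close>

definition twist_quad :: "nat \<Rightarrow> (twist_tet \<Rightarrow> 'a::comm_ring_1) \<Rightarrow> 'a \<Rightarrow> 'a" where
  "twist_quad p y x =
     (\<Sum>j = 1..p. \<Sum>k = 1..p. of_nat (min j k) * y (TT j) * y (TT k))
     - 2 * y TU * (\<Sum>k = 1..p. of_nat k * y (TT k))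
     + of_nat p * (y TU)\<^sup>2 + y TU * y TW + x * (x - y TU - y TW)"

text \<open>
  The polarization \<open>q(y + s) - q(y) - q(s)\<close> of \<open>twist_quad\<close>, arranged by the coordinates of the first
  argument in the tower.
\<close>

definition twist_quad_polar ::
  "nat \<Rightarrow> (twist_tet \<Rightarrow> 'a::comm_ring_1) \<Rightarrow> 'a \<Rightarrow> (twist_tet \<Rightarrow> 'a) \<Rightarrow> 'a \<Rightarrow> 'a" where
  "twist_quad_polar p y x s m =
     (\<Sum>k = 1..p. y (TT k) * (2 * (\<Sum>j = 1..p. of_nat (min j k) * s (TT j)) - 2 * of_nat k * s TU))
     - 2 * y TU * (\<Sum>k = 1..p. of_nat k * s (TT k)) + 2 * of_nat p * y TU * s TU
     + y TU * s TW + s TU * y TW + 2 * x * m - x * s TU - m * y TU - x * s TW - m * y TW"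

lemma twist_quad_add:
  fixes y s :: "twist_tet \<Rightarrow> 'a::comm_ring_1"
  shows "twist_quad p (\<lambda>T. y T + h * s T) (x + h * m)
    = twist_quad p y x + h * twist_quad_polar p y x s m + h\<^sup>2 * twist_quad p s m"
proof -
  define S where "S = (\<lambda>(y :: twist_tet \<Rightarrow> 'a) s. \<Sum>j = 1..p. \<Sum>k = 1..p. of_nat (min j k) * y (TT j) * s (TT k))"
  define L where "L = (\<lambda>y :: twist_tet \<Rightarrow> 'a. \<Sum>k = 1..p. of_nat k * y (TT k))"
  have sym: "S s y = S y s"
    unfolding S_def by (subst sum.swap) (simp add: min.commute mult_ac)
  have S_add: "S (\<lambda>T. y T + h * s T) (\<lambda>T. y T + h * s T) = S y y + h * (2 * S y s) + h\<^sup>2 * S s s"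
  proof -
    have "S (\<lambda>T. y T + h * s T) (\<lambda>T. y T + h * s T) = S y y + h * S y s + h * S s y + h\<^sup>2 * S s s"
      unfolding S_def by (simp add: algebra_simps sum.distrib sum_distrib_left power2_eq_square)
    then show ?thesis unfolding sym by (simp add: algebra_simps)
  qed
  have L_add: "L (\<lambda>T. y T + h * s T) = L y + h * L s"
    unfolding L_def by (simp add: algebra_simps sum.distrib sum_distrib_left)
  have quad: "twist_quad p y x = S y y - 2 * y TU * L y + of_nat p * (y TU)\<^sup>2 + y TU * y TW + x * (x - y TU - y TW)"
    for y x unfolding twist_quad_def S_def L_def by (rule refl)
  have "(\<Sum>k = 1..p. y (TT k) * (2 * (\<Sum>j = 1..p. of_nat (min j k) * s (TT j)) - 2 * of_nat k * s TU))
      = 2 * S y s - 2 * s TU * L y"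
    unfolding S_def L_def
    by (simp add: algebra_simps sum_subtractf sum_distrib_left min.commute)
  then have polar: "twist_quad_polar p y x s m = 2 * S y s - 2 * s TU * L y - 2 * y TU * L s + 2 * of_nat p * y TU * s TU
     + y TU * s TW + s TU * y TW + 2 * x * m - x * s TU - m * y TU - x * s TW - m * y TW"
    unfolding twist_quad_polar_def L_def by (simp only:)
  show ?thesis
    unfolding quad polar S_add L_add
    by (simp add: algebra_simps power2_eq_square)
qed

lemma Q_mat_quadratic_form:
  "(\<Sum>i\<in>J_index p. \<Sum>j\<in>J_index p. y i * of_real (Q_mat p i j) * y j) + x * (x - y TU - y TW) = twist_quad p y (x :: complex)"
proof -
  define L where "L = (\<Sum>k = 1..p. of_nat k * y (TT k))"
  have T: "(\<Sum>j\<in>J_index p. y (TT k) * of_real (Q_mat p (TT k) j) * y j)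
      = (\<Sum>j = 1..p. of_nat (min k j) * y (TT k) * y (TT j)) - y TU * (of_nat k * y (TT k))" for k
    by (simp add: sum_J_index mult_ac)
  have U: "(\<Sum>j\<in>J_index p. y TU * of_real (Q_mat p TU j) * y j)
      = - (y TU * L) + of_nat p * (y TU)\<^sup>2 + 1 / 2 * (y TU * y TW)"
    by (simp add: sum_J_index L_def sum_negf sum_distrib_left power2_eq_square mult_ac)
  have W: "(\<Sum>j\<in>J_index p. y TW * of_real (Q_mat p TW j) * y j) = 1 / 2 * (y TU * y TW)"
    by (simp add: sum_J_index)
  have "(\<Sum>i\<in>J_index p. \<Sum>j\<in>J_index p. y i * of_real (Q_mat p i j) * y j)
      = (\<Sum>j = 1..p. \<Sum>k = 1..p. of_nat (min j k) * y (TT j) * y (TT k)) - y TU * L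
        + (- (y TU * L) + of_nat p * (y TU)\<^sup>2 + 1 / 2 * (y TU * y TW)) + 1 / 2 * (y TU * y TW)"
    unfolding sum_J_index[of "\<lambda>i. \<Sum>j\<in>J_index p. y i * of_real (Q_mat p i j) * y j"] T U W
    unfolding L_def by (simp only: sum_subtractf sum_distrib_left)
  then show ?thesis by (simp add: twist_quad_def L_def)
qed

text \<open>
  The signed exponent is \<open>\<Sum> e\<^sub>k t\<^sub>k - r t\<^sub>U - g t\<^sub>V - u t\<^sub>W\<close>; with \<open>x = t\<^sub>V - t\<^sub>U\<close> the last faces are
  \<open>u = x\<close>, \<open>g = t\<^sub>U - x\<close> and \<open>r = x + e\<^sub>p\<^sub>+\<^sub>1 - t\<^sub>W\<close>.
\<close>

lemma twist_kernel_exponent: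
  "(\<Sum>T\<in>insert TV (J_index p). of_int (sgn_tet (twist_triangulation p) T) * twist_delta_solution p t (twist_faces p T ! 0) * t T)
     = twist_quad p t (t TV - t TU)"
proof -
  define L where "L = (\<Sum>k = 1..p. real k * t (TT k))"
  have Lp: "(\<Sum>k = 1..p. real (min k (Suc p)) * t (TT k)) = L"
    unfolding L_def by (intro sum.cong) auto
  have e: "(\<Sum>k = 1..p. twist_delta_solution p t (Fe k) * t (TT k))
      = (\<Sum>j = 1..p. \<Sum>k = 1..p. real (min j k) * t (TT j) * t (TT k)) - t TU * L"
  proof -
    have "twist_delta_solution p t (Fe k) * t (TT k)
        = (\<Sum>j = 1..p. real (min j k) * t (TT j) * t (TT k)) - t TU * (real k * t (TT k))" for k
      by (simp add: twist_delta_solution_def algebra_simps sum_distrib_left)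
    then have "(\<Sum>k = 1..p. twist_delta_solution p t (Fe k) * t (TT k))
        = (\<Sum>k = 1..p. \<Sum>j = 1..p. real (min j k) * t (TT j) * t (TT k)) - t TU * L"
      unfolding L_def by (simp only: sum_subtractf sum_distrib_left)
    then show ?thesis by (subst sum.swap) simp
  qed
  have fin: "TV \<notin> J_index p" by simp
  have "(\<Sum>T\<in>insert TV (J_index p). of_int (sgn_tet (twist_triangulation p) T) * twist_delta_solution p t (twist_faces p T ! 0) * t T)
     = (\<Sum>k = 1..p. twist_delta_solution p t (Fe k) * t (TT k))
       - twist_delta_solution p t Fg * t TV - twist_delta_solution p t Fr * t TU - twist_delta_solution p t Fu * t TW"
    using fin by (simp add: sum_J_index twist_triangulation_def)
  also have "\<dots> = twist_quad p t (t TV - t TU)"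
    unfolding e by (simp add: twist_delta_solution_def twist_quad_def Let_def Lp algebra_simps power2_eq_square)
      (simp add: L_def)
  finally show ?thesis .
qed

lemma kinematical_kernel_twist:
  "kinematical_kernel (twist_triangulation p) t = exp (2 * \<i> * of_real pi * of_real (twist_quad p t (t TV - t TU)))"
proof -
  let ?X = "twist_triangulation p"
  have "(\<Prod>T\<in>set (tets ?X). exp (2 * \<i> * of_real pi * of_int (sgn_tet ?X T)
           * of_real (delta_solution ?X t (face ?X T 0)) * of_real (t T)))
     = (\<Prod>T\<in>set (tets ?X). exp (2 * \<i> * of_real pi *
           of_real (of_int (sgn_tet ?X T) * twist_delta_solution p t (twist_faces p T ! 0) * t T)))"
    using face_in_face_list[of _ ?X 0] by (intro prod.cong refl) (simp add: delta_solution_twist mult_ac)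
  also have "\<dots> = exp (2 * \<i> * of_real pi * of_real (\<Sum>T\<in>set (tets ?X).
       of_int (sgn_tet ?X T) * twist_delta_solution p t (twist_faces p T ! 0) * t T))"
    by (simp add: exp_sum sum_distrib_left)
  finally show ?thesis
    unfolding set_tets_twist twist_kernel_exponent
    using delta_matrix_twist[of p] by (simp add: kinematical_kernel_def Let_def set_tets_twist)
qed

section \<open>Comparison of the two integrands\<close>

lemma twist_quad_of_real:
  "twist_quad p (\<lambda>T. of_real (y T)) (of_real x) = (of_real (twist_quad p y x) :: complex)"
  by (simp add: twist_quad_def)

lemma twist_quad_polar_of_real:
  "twist_quad_polar p (\<lambda>T. of_real (y T)) (of_real x) (\<lambda>T. of_real (s T)) (of_real m)
     = (of_real (twist_quad_polar p y x s m) :: complex)"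
  by (simp add: twist_quad_polar_def)

lemma sum_min:
  assumes "k \<le> p"
  shows "(\<Sum>j = 1..p. real (min j k)) = real k * real p - real k * (real k - 1) / 2"
  using assms
proof (induction k)
  case (Suc k)
  have "(\<Sum>j = 1..p. real (min j (Suc k))) = (\<Sum>j = 1..p. real (min j k) + of_bool (k < j))"
    by (intro sum.cong) (auto simp: min_def)
  also have "(\<Sum>j = 1..p. real (min j k) + of_bool (k < j)) = (\<Sum>j = 1..p. real (min j k)) + real (p - k)"
  proof -
    have "{1..p} \<inter> {j. k < j} = {Suc k..p}" by auto
    then show ?thesis by (simp add: sum.distrib of_bool_def sum.If_cases)
  qed
  finally show ?case using Suc by (simp add: of_nat_diff field_simps)
qed simp

text \<open>
  The height of the contour in the coordinate \<open>T\<close>, in units of \<open>1 / (2 \<pi> sqrt hbar)\<close>; it also gives the height of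
  \<open>y\<^sub>V = y\<^sub>U + x\<close>.
\<close>

definition contour_height :: "(twist_tet \<Rightarrow> real) \<Rightarrow> twist_tet \<Rightarrow> real" where
  "contour_height a T = (case T of TT k \<Rightarrow> - (pi - a T) | _ \<Rightarrow> pi - a T)"

text \<open>
  The coefficients of \<open>v\<^sub>k\<close>, \<open>v\<^sub>U\<close>, \<open>v\<^sub>W\<close> and \<open>u\<close> are compared separately.  The entries of \<open>W\<^sub>n\<close> compensate
  the contribution of the constants \<open>\<pi>\<close> in the heights, as \<open>\<Sum>\<^sub>j min(j, k) = k p - k (k - 1) / 2\<close>; what
  remains is the system of angle equations.  The coefficient of \<open>v\<^sub>U\<close> is \<open>c\<^sub>U + c\<^sub>V\<close>, since
  \<open>t\<^sub>V = u + v\<^sub>U\<close>.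
\<close>

lemma twist_linear_identity:
  assumes abc: "(a, b, c) \<in> angle_structures (twist_triangulation p)"
  defines "s \<equiv> contour_height a"
  defines "mu \<equiv> a TU - a TV" and "lam \<equiv> 2 * (a TU - a TV + c TV - b TW)"
  shows "(\<Sum>T\<in>J_index p. v T * W_vec p T) - pi * u + u * lam / 2 - twist_quad_polar p v u s mu
     = (\<Sum>T\<in>J_index p. c T * v T) + c TV * (u + v TU)"
proof -
  note eqs = twist_angle_equations[OF abc]
  have W: "a TW + b TW + c TW = pi"
    using abc unfolding angle_structures_def set_tets_twist by auto
  have s: "s (TT k) = a (TT k) - pi" "s TU = pi - a TU" "s TW = pi - a TW" for k
    by (simp_all add: s_def contour_height_def)
  have tower: "W_vec p (TT k) - (2 * (\<Sum>j = 1..p. of_nat (min j k) * s (TT j)) - 2 * of_nat k * s TU) = c (TT k)"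
    if "k \<in> {1..p}" for k
  proof -
    have "(\<Sum>j = 1..p. of_nat (min j k) * s (TT j))
        = (\<Sum>j = 1..p. real (min j k) * a (TT j)) - pi * (\<Sum>j = 1..p. real (min j k))"
      by (simp add: s right_diff_distrib sum_subtractf sum_distrib_left mult.commute)
    moreover have "W_vec p (TT k) = - 2 * pi * (\<Sum>j = 1..p. real (min j k))"
      using sum_min[of k p] that by simp
    ultimately show ?thesis
      unfolding eqs(2)[OF that] by (simp only: s(2)) (simp add: algebra_simps)
  qed
  have gauss: "(\<Sum>k = 1..p. real k) = real p * (real p + 1) / 2"
  proof -
    have "(\<Sum>k = 1..p. real k) = (\<Sum>k = 1..p. real (min k p))" by (intro sum.cong) auto
    then show ?thesis using sum_min[of p p] by (simp add: field_simps)
  qed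
  have L: "(\<Sum>k = 1..p. of_nat k * s (TT k)) = (\<Sum>k = 1..p. real k * a (TT k)) - pi * (real p * (real p + 1) / 2)"
    unfolding gauss[symmetric] by (simp add: s right_diff_distrib sum_subtractf sum_distrib_left mult.commute)
  have "(\<Sum>k = 1..p. v (TT k) * W_vec p (TT k))
       - (\<Sum>k = 1..p. v (TT k) * (2 * (\<Sum>j = 1..p. of_nat (min j k) * s (TT j)) - 2 * of_nat k * s TU))
     = (\<Sum>k = 1..p. c (TT k) * v (TT k))"
    unfolding sum_subtractf[symmetric] right_diff_distrib[symmetric]
    using tower by (intro sum.cong refl) (simp add: mult.commute)
  then have "(\<Sum>T\<in>J_index p. v T * W_vec p T) - twist_quad_polar p v u s mu
     = (\<Sum>k = 1..p. c (TT k) * v (TT k)) + v TU * W_vec p TU + v TW * W_vec p TW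
       + 2 * v TU * (\<Sum>k = 1..p. of_nat k * s (TT k)) - 2 * of_nat p * v TU * s TU
       - v TU * s TW - s TU * v TW - 2 * u * mu + u * s TU + mu * v TU + u * s TW + mu * v TW"
    unfolding sum_J_index twist_quad_polar_def by linarith
  also have "\<dots> = (\<Sum>k = 1..p. c (TT k) * v (TT k)) + v TU * (W_vec p TU + 2 * (\<Sum>k = 1..p. of_nat k * s (TT k))
        - 2 * real p * s TU - s TW + mu) + v TW * (W_vec p TW - s TU + mu) + u * (s TU + s TW - 2 * mu)"
    by (simp add: algebra_simps)
  also have "W_vec p TU + 2 * (\<Sum>k = 1..p. of_nat k * s (TT k)) - 2 * real p * s TU - s TW + mu = c TU + c TV"
    unfolding L using eqs(3) by (simp add: s mu_def algebra_simps power2_eq_square add_divide_distrib)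
  also have "W_vec p TW - s TU + mu = c TW"
    using eqs(1) by (simp add: s mu_def)
  also have "u * (s TU + s TW - 2 * mu) = u * (pi + c TV - lam / 2)"
  proof -
    have "s TU + s TW - 2 * mu = pi + c TV - lam / 2"
    proof -
      have half: "lam / 2 = a TU - a TV + c TV - b TW" by (simp add: lam_def)
      have "b TW = pi - a TW - 2 * a TU + a TV" using eqs(1) W by simp
      then show ?thesis by (simp add: s mu_def half)
    qed
    then show ?thesis by simp
  qed
  finally show ?thesis
    unfolding sum_J_index by (simp add: algebra_simps)
qed

lemma prod_J_index: "(\<Prod>T\<in>J_index p. h T) = (\<Prod>k = 1..p. h (TT k)) * h TU * h TW"
proof -
  have "(\<Prod>T\<in>J_index p. h T) = (\<Prod>T\<in>TT ` {1..p}. h T) * (\<Prod>T\<in>{TU, TW}. h T)"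
    unfolding J_index_def by (rule prod.union_disjoint) auto
  then show ?thesis by (simp add: prod.reindex inj_on_def mult.assoc)
qed

lemma partition_integrand_twist:
  "partition_integrand \<beta> (twist_triangulation p) (a, b, c) t
     = exp (2 * \<i> * of_real pi * of_real (twist_quad p t (t TV - t TU)))
       * (\<Prod>T\<in>insert TV (J_index p). tet_factor \<beta> (sgn_tet (twist_triangulation p) T) (a T) (c T) (t T))"
  by (simp add: partition_integrand_def kinematical_kernel_twist dynamical_content_def tet_factor_def set_tets_twist)

text \<open>
  Expanding the quadratic form at \<open>y = v + i \<kappa> s\<close> and \<open>x = u + i \<kappa> \<mu>\<close> with real \<open>v\<close>, \<open>s\<close>, \<open>u\<close>, \<open>\<mu>\<close>, every exponent is
  a real linear form in \<open>(v, u)\<close>, plus \<open>2 \<pi> i\<close> times the quadratic form at the real point, plus an imaginary constant.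
  The linear forms add up by \<open>twist_linear_identity\<close>, and the constants make up the phase \<open>\<theta>\<close>.
\<close>

lemma partition_integrand_shear:
  assumes "\<beta> > 0" and abc: "(a, b, c) \<in> angle_structures (twist_triangulation p)"
  defines "mu \<equiv> a TU - a TV" and "lam \<equiv> 2 * (a TU - a TV + c TV - b TW)"
  defines "x \<equiv> \<lambda>u. of_real u + \<i> * of_real (mu / (2 * pi * sqrt (hbar \<beta>)))"
  shows "\<exists>\<theta>. \<forall>u v. J_integrand \<beta> p (x u) (Y_point \<beta> a v) * exp (1 / (2 * of_real (sqrt (hbar \<beta>))) * x u * of_real lam)
     = cis \<theta> * partition_integrand \<beta> (twist_triangulation p) (a, b, c) (v(TV := u + v TU))"
proof -
  define Q where "Q = \<beta> + 1 / \<beta>"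
  define \<kappa> where "\<kappa> = Q / (2 * pi)"
  define s where "s = contour_height a"
  have sq: "sqrt (hbar \<beta>) = 1 / Q" using sqrt_hbar[OF assms(1)] by (simp add: Q_def)
  have Q0: "Q > 0" using assms(1) by (simp add: Q_def add_pos_pos)
  have kap: "2 * pi * \<kappa> = Q" by (simp add: \<kappa>_def)
  have Y: "Y_point \<beta> a v = (\<lambda>T. of_real (v T) + (\<i> * of_real \<kappa>) * of_real (s T))" for v
    using Q0 by (auto simp: fun_eq_iff Y_point_def s_def contour_height_def sq \<kappa>_def split: twist_tet.split)
       (simp only: minus_divide_left mult_minus_right[symmetric] minus_diff_eq)
  have x: "x u = of_real u + (\<i> * of_real \<kappa>) * of_real mu" for u
    using Q0 by (simp add: x_def sq \<kappa>_def)
  define \<theta> where "\<theta> = - 2 * pi * \<kappa>\<^sup>2 * twist_quad p s mu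
      + Q * \<kappa> * ((\<Sum>T\<in>J_index p. s T * W_vec p T) - pi * mu + mu * lam / 2)"
  have "J_integrand \<beta> p (x u) (Y_point \<beta> a v) * exp (1 / (2 * of_real (sqrt (hbar \<beta>))) * x u * of_real lam)
     = cis \<theta> * partition_integrand \<beta> (twist_triangulation p) (a, b, c) (v(TV := u + v TU))" for u v
  proof -
    let ?y = "Y_point \<beta> a v"
    let ?t = "v(TV := u + v TU)"
    define R where "R = quantum_dilog \<beta> (?y TU) * quantum_dilog \<beta> (?y TU + x u) * quantum_dilog \<beta> (?y TW)
      / (\<Prod>k=1..p. quantum_dilog \<beta> (?y (TT k)))"
    define q where "q = twist_quad p v u"
    define d where "d = twist_quad_polar p v u s mu"
    define r where "r = twist_quad p s mu"
    have quad: "(\<Sum>i\<in>J_index p. \<Sum>j\<in>J_index p. ?y i * of_real (Q_mat p i j) * ?y j) + x u * (x u - ?y TU - ?y TW)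
        = of_real q + (\<i> * of_real \<kappa>) * of_real d + (\<i> * of_real \<kappa>)\<^sup>2 * of_real r"
      unfolding Q_mat_quadratic_form unfolding Y x twist_quad_add twist_quad_of_real twist_quad_polar_of_real
      by (simp add: q_def d_def r_def)
    have 1: "2 * \<i> * of_real pi * ((\<Sum>i\<in>J_index p. \<Sum>j\<in>J_index p. ?y i * of_real (Q_mat p i j) * ?y j) + x u * (x u - ?y TU - ?y TW))
        = Complex (- (2 * pi * \<kappa>) * d) (2 * pi * q - 2 * pi * \<kappa>\<^sup>2 * r)"
      unfolding quad by (simp add: complex_eq_iff power_mult_distrib algebra_simps)
    have 2: "1 / of_real (sqrt (hbar \<beta>)) * ((\<Sum>i\<in>J_index p. ?y i * of_real (W_vec p i)) - of_real pi * x u)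
        = Complex (Q * ((\<Sum>T\<in>J_index p. v T * W_vec p T) - pi * u)) (Q * \<kappa> * ((\<Sum>T\<in>J_index p. s T * W_vec p T) - pi * mu))"
      unfolding Y x sq using Q0
      by (simp add: complex_eq_iff sum_distrib_left algebra_simps)
    have 3: "1 / (2 * of_real (sqrt (hbar \<beta>))) * x u * of_real lam
        = Complex (Q * (u * lam / 2)) (Q * \<kappa> * (mu * lam / 2))"
      unfolding x sq using Q0 by (simp add: complex_eq_iff)
    have lin: "(\<Sum>T\<in>J_index p. v T * W_vec p T) - pi * u + u * lam / 2 - d
        = (\<Sum>T\<in>J_index p. c T * v T) + c TV * (u + v TU)"
      using twist_linear_identity[OF abc, of v u] by (simp add: d_def s_def mu_def lam_def)
    have re: "- (2 * pi * \<kappa>) * d + Q * ((\<Sum>T\<in>J_index p. v T * W_vec p T) - pi * u) + Q * (u * lam / 2)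
        = Q * ((\<Sum>T\<in>J_index p. c T * v T) + c TV * (u + v TU))"
      unfolding lin[symmetric] kap by (simp add: algebra_simps)
    have im: "2 * pi * q - 2 * pi * \<kappa>\<^sup>2 * r + Q * \<kappa> * ((\<Sum>T\<in>J_index p. s T * W_vec p T) - pi * mu) + Q * \<kappa> * (mu * lam / 2)
        = \<theta> + 2 * pi * q"
      unfolding \<theta>_def r_def by (simp add: algebra_simps)
    have "J_integrand \<beta> p (x u) ?y * exp (1 / (2 * of_real (sqrt (hbar \<beta>))) * x u * of_real lam)
        = exp (Complex (- (2 * pi * \<kappa>) * d) (2 * pi * q - 2 * pi * \<kappa>\<^sup>2 * r)
            + Complex (Q * ((\<Sum>T\<in>J_index p. v T * W_vec p T) - pi * u)) (Q * \<kappa> * ((\<Sum>T\<in>J_index p. s T * W_vec p T) - pi * mu))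
            + Complex (Q * (u * lam / 2)) (Q * \<kappa> * (mu * lam / 2))) * R"
      unfolding J_integrand_def 1 2 3 R_def[symmetric] exp_add by (simp only: mult_ac)
    also have "\<dots> = exp (Complex (Q * ((\<Sum>T\<in>J_index p. c T * v T) + c TV * (u + v TU))) (\<theta> + 2 * pi * q)) * R"
      by (simp only: complex_add re im)
    also have "\<dots> = cis \<theta> * (exp (2 * \<i> * of_real pi * of_real q)
        * (of_real (exp (Q * ((\<Sum>T\<in>J_index p. c T * v T) + c TV * (u + v TU)))) * R))"
    proof -
      have "exp (Complex z (\<theta> + 2 * pi * q)) = cis \<theta> * (exp (2 * \<i> * of_real pi * of_real q) * of_real (exp z))" for z
        by (simp add: Complex_eq exp_add cis_conv_exp distrib_left exp_of_real mult_ac)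
      then show ?thesis by (simp only: mult.assoc)
    qed
    also have "of_real (exp (Q * ((\<Sum>T\<in>J_index p. c T * v T) + c TV * (u + v TU)))) * R
        = (\<Prod>T\<in>insert TV (J_index p). tet_factor \<beta> (sgn_tet (twist_triangulation p) T) (a T) (c T) (?t T))"
    proof -
      have growth: "exp (of_real (c' * t' / sqrt (hbar \<beta>))) = (of_real (exp (Q * (c' * t'))) :: complex)" for c' t'
        unfolding exp_of_real by (simp add: sq mult_ac)
      have div_inverse: "z / inverse w = z * w" for z w :: complex by (simp add: divide_inverse)
      have tet: "tet_factor \<beta> 1 (a (TT k)) (c (TT k)) (v (TT k))
          = of_real (exp (Q * (c (TT k) * v (TT k)))) * (1 / quantum_dilog \<beta> (?y (TT k)))" for k
        unfolding tet_factor_def growth by (simp add: Y_point_def)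
      have UW: "tet_factor \<beta> (- 1) (a T) (c T) (v T) = of_real (exp (Q * (c T * v T))) * quantum_dilog \<beta> (?y T)"
        if "T = TU \<or> T = TW" for T
        unfolding tet_factor_def growth using that by (auto simp: Y_point_def power_int_minus div_inverse)
      have argV: "of_real (u + v TU) - \<i> / of_real (2 * pi * sqrt (hbar \<beta>)) * of_int (- 1) * of_real (pi - a TV) = ?y TU + x u"
        unfolding Y x using Q0 by (simp add: sq \<kappa>_def s_def contour_height_def mu_def complex_eq_iff field_simps)
      have V: "tet_factor \<beta> (- 1) (a TV) (c TV) (u + v TU)
          = of_real (exp (Q * (c TV * (u + v TU)))) * quantum_dilog \<beta> (?y TU + x u)"
        unfolding tet_factor_def growth argV by (simp add: power_int_minus div_inverse)
      have sgn: "sgn_tet (twist_triangulation p) (TT k) = 1" "sgn_tet (twist_triangulation p) TU = - 1"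
        "sgn_tet (twist_triangulation p) TV = - 1" "sgn_tet (twist_triangulation p) TW = - 1" for k
        by (simp_all add: twist_triangulation_def)
      have "(\<Prod>T\<in>insert TV (J_index p). tet_factor \<beta> (sgn_tet (twist_triangulation p) T) (a T) (c T) (?t T))
        = of_real (exp (Q * (c TV * (u + v TU)))) * quantum_dilog \<beta> (?y TU + x u)
          * ((\<Prod>k = 1..p. of_real (exp (Q * (c (TT k) * v (TT k)))) * (1 / quantum_dilog \<beta> (?y (TT k))))
             * (of_real (exp (Q * (c TU * v TU))) * quantum_dilog \<beta> (?y TU))
             * (of_real (exp (Q * (c TW * v TW))) * quantum_dilog \<beta> (?y TW)))"
        by (simp add: prod_J_index sgn tet UW V)
      also have "(\<Prod>k = 1..p. of_real (exp (Q * (c (TT k) * v (TT k)))) * (1 / quantum_dilog \<beta> (?y (TT k))))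
        = of_real (exp (Q * (\<Sum>k = 1..p. c (TT k) * v (TT k)))) / (\<Prod>k = 1..p. quantum_dilog \<beta> (?y (TT k)))"
        unfolding prod.distrib by (simp add: sum_distrib_left exp_sum prod_dividef of_real_prod)
      finally show ?thesis
        unfolding R_def sum_J_index by (simp add: distrib_left exp_add mult_ac)
    qed
    also have "q = twist_quad p ?t (?t TV - ?t TU)"
      by (simp add: q_def twist_quad_def)
    finally show ?thesis unfolding partition_integrand_twist .
  qed
  then show ?thesis by blast
qed

theorem theorem5p2:
  fixes n p :: nat and \<beta> mu lam :: real and a b c :: "twist_tet \<Rightarrow> real"
    and x :: "real \<Rightarrow> complex"
  assumes "odd n" and "n \<ge> 3" and "p = (n - 3) div 2"
    and "\<beta> > 0"
    and "(a, b, c) \<in> angle_structures (twist_triangulation p)"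
    and "mu = a TU - a TV"
    and "lam = 2 * (a TU - a TV + c TV - b TW)"
    and "x = (\<lambda>u. of_real u + \<i> * of_real (mu / (2 * pi * sqrt (hbar \<beta>))))"
  shows "integrable (\<Pi>\<^sub>M T\<in>set (tets (twist_triangulation p)). lborel)
           (partition_integrand \<beta> (twist_triangulation p) (a, b, c))
       \<and> (\<forall>u. integrable (\<Pi>\<^sub>M T\<in>J_index p. lborel)
                (\<lambda>v. J_integrand \<beta> p (x u) (Y_point \<beta> a v)))
       \<and> integrable lborel
           (\<lambda>u. J_fun \<beta> p a (x u) * exp (1 / (2 * of_real (sqrt (hbar \<beta>))) * x u * of_real lam))
       \<and> cmod (partition_function \<beta> (twist_triangulation p) (a, b, c)) =
         cmod (LINT u|lborel.
           J_fun \<beta> p a (x u) * exp (1 / (2 * of_real (sqrt (hbar \<beta>))) * x u * of_real lam))"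
proof -
  note abc = assms(5)
  let ?X = "twist_triangulation p"
  let ?M = "\<Pi>\<^sub>M T\<in>insert TV (J_index p). (lborel :: real measure)"
  define F where "F = partition_integrand \<beta> ?X (a, b, c)"
  define E where "E u = exp (1 / (2 * of_real (sqrt (hbar \<beta>))) * x u * of_real lam)" for u
  define fac where "fac T = tet_factor \<beta> (sgn_tet ?X T) (a T) (c T)" for T
  have sgn: "sgn_tet ?X T = 1 \<or> sgn_tet ?X T = - 1" for T
    by (cases T) (auto simp: twist_triangulation_def)
  have angles: "0 < a T" "0 < b T" "0 < c T" "a T + b T + c T = pi" "a T < pi" if "T \<in> insert TV (J_index p)" for T
    using abc that unfolding angle_structures_def set_tets_twist by auto
  have comp [measurable]: "(\<lambda>t. t T) \<in> borel_measurable ?M" if "T \<in> insert TV (J_index p)" for T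
    using measurable_component_singleton[OF that, of "\<lambda>_. lborel :: real measure"] by simp
  have fac_meas: "(\<lambda>t. fac T (t T)) \<in> borel_measurable ?M" if "T \<in> insert TV (J_index p)" for T
    unfolding fac_def
    by (rule measurable_compose[OF comp[OF that] tet_factor_measurable]) (use assms(4) sgn angles[OF that] in auto)
  have F_eq: "F t = exp (2 * \<i> * of_real pi * of_real (twist_quad p t (t TV - t TU)))
       * (\<Prod>T\<in>insert TV (J_index p). fac T (t T))" for t
    unfolding F_def partition_integrand_twist fac_def ..
  have quad_meas: "(\<lambda>t. twist_quad p t (t TV - t TU)) \<in> borel_measurable ?M"
    unfolding twist_quad_def
    by (intro borel_measurable_add borel_measurable_diff borel_measurable_times borel_measurable_sum
          borel_measurable_power borel_measurable_const comp) auto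
  have F_meas: "F \<in> borel_measurable ?M"
    unfolding F_eq[abs_def] using quad_meas fac_meas
    by (intro borel_measurable_times borel_measurable_prod measurable_compose[OF _ borel_measurable_exp]) auto
  have norm_F: "norm (F t) = (\<Prod>T\<in>insert TV (J_index p). norm (fac T (t T)))" for t
    unfolding F_eq norm_mult by (simp add: norm_exp_eq_Re prod_norm)
  have fac_int: "integrable lborel (\<lambda>s. norm (fac T s))" if "T \<in> insert TV (J_index p)" for T
    unfolding fac_def using assms(4) sgn angles[OF that] by (intro tet_factor_integrable(1)[where b = "b T"]) auto
  obtain M where M: "\<And>s. norm (fac TV s) \<le> M"
    using tet_factor_integrable(2)[OF assms(4) sgn[of TV] angles(1-4)[of TV]] unfolding fac_def by auto
  note shear = integral_shear[where g = "\<lambda>T s. norm (fac T s)" and F = F and I = "J_index p" and ?i0.0 = TV and ?i1.0 = TU,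
      OF finite_J_index J_index_simps(1,2) F_meas norm_F fac_int norm_ge_zero M]
  obtain \<theta> where \<theta>: "\<And>u v. J_integrand \<beta> p (x u) (Y_point \<beta> a v) * E u = cis \<theta> * F (v(TV := u + v TU))"
    using partition_integrand_shear[OF assms(4) abc] unfolding assms(6,7,8) E_def F_def by blast
  have J_eq: "J_integrand \<beta> p (x u) (Y_point \<beta> a v) = cis \<theta> / E u * F (v(TV := u + v TU))" for u v
    using \<theta>[of u v] by (simp add: E_def field_simps)
  have J_fun_eq: "J_fun \<beta> p a (x u) * E u = cis \<theta> * (LINT v|(\<Pi>\<^sub>M T\<in>J_index p. lborel). F (v(TV := u + v TU)))" for u
    unfolding J_fun_def J_eq by (simp add: E_def)
  have "integrable ?M F" by (rule shear(1))
  moreover have "integrable (\<Pi>\<^sub>M T\<in>J_index p. lborel) (\<lambda>v. J_integrand \<beta> p (x u) (Y_point \<beta> a v))" for u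
    unfolding J_eq by (intro integrable_mult_right shear(2))
  moreover have "integrable lborel (\<lambda>u. J_fun \<beta> p a (x u) * E u)"
    unfolding J_fun_eq by (intro integrable_mult_right shear(3))
  moreover have "cmod (LINT t|?M. F t) = cmod (LINT u|lborel. J_fun \<beta> p a (x u) * E u)"
  proof -
    have "(LINT t|?M. F t) = (LINT u|lborel. LINT v|(\<Pi>\<^sub>M T\<in>J_index p. lborel). F (v(TV := u + v TU)))"
      by (rule shear(4))
    then show ?thesis unfolding J_fun_eq by (simp add: norm_mult)
  qed
  ultimately show ?thesis
    unfolding set_tets_twist partition_function_def F_def[symmetric] E_def by blast
qed

end
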